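(* Let $a,b,c$ be positive integers with $b\ge a+c-1$. Then the number of lozenge tilings of the region $H_{\mathrm a}(a,b,c)$ is $$L(H_{\mathrm a}(a,b,c))=P_a(b-a,\,c),$$ where $$P_n(x,y)=\prod_{j=1}^{n}\frac{(j-1)!\,(x+y+2j)!\,(x-y+2j+1)_j\,(x+2y+3j+1)_{n-j}}{(x+n+2j)!\,(y+n-j)!}.$$
   Context: Shifted factorial: $(\alpha)_k=\alpha(\alpha+1)\cdots(\alpha+k-1)$ for $k\ge1$, and $(\alpha)_0=1$. Triangular lattice: let $e=(1,0)$, $f=(1/2,\sqrt3/2)$, $g=f-e=(-1/2,\sqrt3/2)$, and consider the lattice $\mathbb Z e+\mathbb Z f$ with its tiling of the plane by unit equilateral triangles. A lozenge is the union of two unit triangles sharing an edge. A lozenge tiling of a region $R$ (a finite union of unit triangles) is a decomposition of $R$ into lozenges with disjoint interiors; $L(R)$ is the number of lozenge tilings of $R$. $H(a,b,c)$ ($a,b,c$ positive integers) is the hexagon with vertices, in counterclockwise order, $0$ (southwestern corner), $be$ (southeastern corner), $be+af$ (eastern corner), $be+af+cg$ (northeastern corner), $af+cg$ (northwestern corner), $cg$ (western corner). Thus its horizontal sides have length $b$, the southeastern and northwestern sides have length $a$, and the northeastern and southwestern sides have length $c$. Maximal staircase at a corner $V$: let $p,q$ be the lengths of the two sides meeting at $V$, let $s,t$ be the unit vectors pointing from $V$ along these two sides (they form an angle of $120^\circ$), and let $m=\min(p,q)$. For $i,j\ge1$ let the cell $(i,j)$ be the lozenge with vertices $V+(i-1)s+(j-1)t$,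 $V+is+(j-1)t$, $V+is+jt$, $V+(i-1)s+jt$. The maximal staircase at $V$ is the union of all cells $(i,j)$ with $i,j\ge1$ and $i+j\le m$ (so it has rows of $m-1,m-2,\dots,1$ lozenges). $H_{\mathrm a}(a,b,c)$ is the region obtained from $H(a,b,c)$ by removing the maximal staircases at the two top corners, i.e. at the northwestern corner (where sides of lengths $a$ and $b$ meet) and at the northeastern corner (where sides of lengths $b$ and $c$ meet). *)

theory Defs
  imports "HOL-Analysis.Analysis"
begin

type_synonym point = "real \<times> real"

definition vec_e :: point where "vec_e = (1, 0)"
definition vec_f :: point where "vec_f = (1/2, sqrt 3 / 2)"
definition vec_g :: point where "vec_g = vec_f - vec_e"

definition tri_lattice :: "point set" where
  "tri_lattice = {of_int m *\<^sub>R vec_e + of_int n *\<^sub>R vec_f | m n :: int. True}"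

text \<open>Every unit triangle of the tiling is either upward pointing, with southwestern vertex \<open>v\<close>,
  or downward pointing, with bottom vertex \<open>v\<close>.\<close>

definition unit_triangles :: "point set set" where
  "unit_triangles =
     {convex hull {v, v + vec_e, v + vec_f} | v. v \<in> tri_lattice} \<union>
     {convex hull {v, v + vec_f, v + vec_g} | v. v \<in> tri_lattice}"

definition share_edge :: "point set \<Rightarrow> point set \<Rightarrow> bool" where
  "share_edge S T \<longleftrightarrow>
     (\<exists>u\<in>tri_lattice. \<exists>v\<in>tri_lattice. dist u v = 1 \<and> S \<inter> T = closed_segment u v)"

definition lozenges :: "point set set" where
  "lozenges = {S \<union> T | S T. S \<in> unit_triangles \<and> T \<in> unit_triangles \<and> share_edge S T}"

definition lozenge_tiling :: "point set \<Rightarrow> point set set \<Rightarrow> bool" where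
  "lozenge_tiling R \<T> \<longleftrightarrow>
     \<T> \<subseteq> lozenges \<and>
     pairwise (\<lambda>A B. interior A \<inter> interior B = {}) \<T> \<and>
     \<Union>\<T> = R"

definition num_tilings :: "point set \<Rightarrow> nat" where
  "num_tilings R = card {\<T>. lozenge_tiling R \<T>}"

definition hexagon :: "nat \<Rightarrow> nat \<Rightarrow> nat \<Rightarrow> point set" where
  "hexagon a b c = convex hull
     {0,
      real b *\<^sub>R vec_e,
      real b *\<^sub>R vec_e + real a *\<^sub>R vec_f,
      real b *\<^sub>R vec_e + real a *\<^sub>R vec_f + real c *\<^sub>R vec_g,
      real a *\<^sub>R vec_f + real c *\<^sub>R vec_g,
      real c *\<^sub>R vec_g}"

definition staircase_cell :: "point \<Rightarrow> point \<Rightarrow> point \<Rightarrow> nat \<Rightarrow> nat \<Rightarrow> point set" where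
  "staircase_cell V s t i j = convex hull
     {V + (real i - 1) *\<^sub>R s + (real j - 1) *\<^sub>R t,
      V + real i *\<^sub>R s + (real j - 1) *\<^sub>R t,
      V + real i *\<^sub>R s + real j *\<^sub>R t,
      V + (real i - 1) *\<^sub>R s + real j *\<^sub>R t}"

text \<open>\<open>V\<close> is the corner; the two sides meeting there have lengths \<open>p\<close>, \<open>q\<close> and leave \<open>V\<close> in the
  directions of the unit vectors \<open>s\<close>, \<open>t\<close> respectively.\<close>

definition maximal_staircase :: "point \<Rightarrow> nat \<Rightarrow> point \<Rightarrow> nat \<Rightarrow> point \<Rightarrow> point set" where
  "maximal_staircase V p s q t =
     \<Union>{staircase_cell V s t i j | i j. 1 \<le> i \<and> 1 \<le> j \<and> i + j \<le> min p q}"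

text \<open>The closure restores the boundary points that the set difference takes away, so that the
  result is again a union of (closed) unit triangles.\<close>

definition hexagon_a :: "nat \<Rightarrow> nat \<Rightarrow> nat \<Rightarrow> point set" where
  "hexagon_a a b c =
     (let NW = real a *\<^sub>R vec_f + real c *\<^sub>R vec_g;
          NE = real b *\<^sub>R vec_e + real a *\<^sub>R vec_f + real c *\<^sub>R vec_g
      in closure (hexagon a b c
           - maximal_staircase NW a (- vec_f) b vec_e
           - maximal_staircase NE b (- vec_e) c (- vec_g)))"

definition P_prod :: "nat \<Rightarrow> nat \<Rightarrow> nat \<Rightarrow> real" where
  "P_prod n x y = (\<Prod>j = 1..n.
     (fact (j - 1) * fact (x + y + 2 * j)
        * pochhammer (real x - real y + 2 * real j + 1) j
        * pochhammer (real x + 2 * real y + 3 * real j + 1) (n - j))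
     / (fact (x + n + 2 * j) * fact (y + n - j)))"

end

theory Submission
  imports Defs "Jordan_Normal_Form.Determinant"
begin

text \<open>
  Write a point of the plane as \<open>u e + v f\<close>. Then every unit triangle is one of the two halves
  \<open>U m n\<close>, \<open>W m n\<close> of a unit rhombus with lower left corner \<open>(m, n)\<close>, and a tiling is the same thing
  as a perfect matching of the triangles of the region along common edges (\<open>num_tilings_region\<close>).
  The region itself becomes a set of triangles given by linear inequalities
  (\<open>hexagon_a_region\<close>). Points none of whose coordinates \<open>u\<close>, \<open>v\<close>, \<open>u + v\<close> is an integer lie in
  exactly one triangle and are dense, so all questions on closures, interiors and unions of
  triangles are questions on index sets.

  Cut the region into strips between the lines \<open>u = k - c\<close>. The lozenges of a tiling that have
  two sides along the strip boundaries form \<open>a\<close> paths, which start at the \<open>a\<close> steps of the left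
  staircase, end at the \<open>a\<close> unit segments of the south-eastern side, and in each strip keep their
  height \<open>v\<close> or lower it by one. Different paths do not meet, and the right staircase is a wall that
  bounds the uppermost path. By the reflection principle the number of paths that leave the
  \<open>i\<close>-th start, respect the wall and reach height \<open>v\<close> on line \<open>k\<close> is a difference of two binomial
  coefficients (\<open>path_count\<close>), and the number of non-intersecting families is the determinant of
  these numbers (\<open>card_dimer_covers_Ha\<close>). Here the determinant is obtained without
  an involution on intersecting families: the tiling is
  built triangle by triangle, and the two ways to cover a triangle \<open>W\<close> are the two summands of
  Pascal's recurrence in one column. Configurations that are impossible because two paths meet
  correspond to determinants with two equal columns; those in which a path leaves the region, to
  determinants with a zero column.

  The determinant is evaluated in two steps. Its columns are odd under the reflection in the wall, so
  unitriangular column operations replace them by the columns that belong to longer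
  binomial coefficients reflected at distance one, for which the difference is a single quotient
  of factorials (ballot numbers). In the resulting array \<open>ballot_entry x y k j\<close>, with \<open>x = b - a\<close> and
  \<open>y = c\<close>, moving by one row or by one column is a shift of \<open>(x, y)\<close> by \<open>(2, -1)\<close> or \<open>(1, 1)\<close>. The
  Desnanot-Jacobi identity therefore is a recurrence for the determinant as a function of its size
  and of \<open>(x, y)\<close>, and the product formula satisfies the same recurrence: after division by
  common factors this is the identity \<open>polynomial_identity\<close>.
\<close>

section \<open>Determinants of arrays\<close>

text \<open>The determinant of the upper left block of an infinite array. Minors that omit outer rows or
  columns are determinants of shifted arrays, so no submatrices have to be formed.\<close>
definition det_fn :: "nat \<Rightarrow> (nat \<Rightarrow> nat \<Rightarrow> 'a::comm_ring_1) \<Rightarrow> 'a" where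
  "det_fn n f = Determinant.det (Matrix.mat n n (\<lambda>(i, j). f i j))"

lemma det_fn_cong:
  assumes "\<And>i j. i < n \<Longrightarrow> j < n \<Longrightarrow> f i j = g i j"
  shows "det_fn n f = det_fn n g"
proof -
  have "Matrix.mat n n (\<lambda>(i, j). f i j) = Matrix.mat n n (\<lambda>(i, j). g i j)"
    by (rule Matrix.eq_matI) (auto simp: assms)
  then show ?thesis by (simp add: det_fn_def)
qed

lemma det_fn_0 [simp]: "det_fn 0 f = 1"
  by (simp add: det_fn_def)

lemma mat_delete_mat:
  assumes "r < Suc n" "s < Suc n"
  shows "mat_delete (Matrix.mat (Suc n) (Suc n) (\<lambda>(i, j). f i j)) r s
    = Matrix.mat n n (\<lambda>(i, j). f (insert_index r i) (insert_index s j))"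
  using assms by (intro Matrix.eq_matI) (auto simp: mat_delete_def insert_index_def)

lemma det_fn_expand_column:
  assumes "s < Suc n"
  shows "det_fn (Suc n) f = (\<Sum>r<Suc n. f r s * ((-1)^(r+s) *
    det_fn n (\<lambda>i j. f (insert_index r i) (insert_index s j))))"
proof -
  let ?A = "Matrix.mat (Suc n) (Suc n) (\<lambda>(i, j). f i j)"
  have "Determinant.det ?A = (\<Sum>r<Suc n. ?A $$ (r, s) * cofactor ?A r s)"
    by (rule laplace_expansion_column) (use assms in auto)
  also have "\<dots> = (\<Sum>r<Suc n. f r s * ((-1)^(r+s) *
    det_fn n (\<lambda>i j. f (insert_index r i) (insert_index s j))))"
    by (intro sum.cong refl) (use assms in \<open>auto simp: cofactor_def mat_delete_mat det_fn_def\<close>)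
  finally show ?thesis by (simp add: det_fn_def)
qed

lemma det_fn_column_single:
  assumes "r < Suc n" "s < Suc n" "\<And>i. i < Suc n \<Longrightarrow> i \<noteq> r \<Longrightarrow> f i s = 0"
  shows "det_fn (Suc n) f = (-1)^(r+s) * f r s * det_fn n (\<lambda>i j. f (insert_index r i) (insert_index s j))"
proof -
  have "det_fn (Suc n) f = (\<Sum>k<Suc n. f k s * ((-1)^(k+s) *
    det_fn n (\<lambda>i j. f (insert_index k i) (insert_index s j))))"
    by (rule det_fn_expand_column) fact
  also have "\<dots> = (\<Sum>k\<in>{r}. f k s * ((-1)^(k+s) *
    det_fn n (\<lambda>i j. f (insert_index k i) (insert_index s j))))"
    by (rule sum.mono_neutral_right) (use assms in auto)
  finally show ?thesis by simp
qed

lemma det_fn_transpose: "det_fn n (\<lambda>i j. f j i) = det_fn n f"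
proof -
  have "Matrix.mat n n (\<lambda>(i, j). f j i) = Matrix.transpose_mat (Matrix.mat n n (\<lambda>(i, j). f i j))"
    by (rule Matrix.eq_matI) auto
  then show ?thesis
    using Determinant.det_transpose[of "Matrix.mat n n (\<lambda>(i, j). f i j)" n] by (simp add: det_fn_def)
qed

lemma det_fn_row_single:
  assumes "r < Suc n" "s < Suc n" "\<And>j. j < Suc n \<Longrightarrow> j \<noteq> s \<Longrightarrow> f r j = 0"
  shows "det_fn (Suc n) f = (-1)^(r+s) * f r s * det_fn n (\<lambda>i j. f (insert_index r i) (insert_index s j))"
  using det_fn_column_single[of s n r "\<lambda>i j. f j i"] assms
    det_fn_transpose[of "Suc n" f] det_fn_transpose[of n "\<lambda>i j. f (insert_index r i) (insert_index s j)"]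
  by (simp add: add.commute)

text \<open>Everything needed about changing one column follows from the existence of the cofactors \<open>C\<close>,
  which do not depend on that column.\<close>
lemma det_fn_linear_in_column:
  fixes f :: "nat \<Rightarrow> nat \<Rightarrow> 'a::comm_ring_1"
  assumes "s < n"
  obtains C where "\<And>h. det_fn n (\<lambda>i j. if j = s then h i else f i j) = (\<Sum>i<n. h i * C i)"
proof -
  obtain m where n: "n = Suc m" using assms by (cases n) auto
  define C where "C r = (-1)^(r+s) * det_fn m (\<lambda>i j. f (insert_index r i) (insert_index s j))" for r
  have "insert_index s j \<noteq> s" for j by (auto simp: insert_index_def)
  then have "det_fn n (\<lambda>i j. if j = s then h i else f i j) = (\<Sum>i<n. h i * C i)" for h
    unfolding n C_def
    by (subst det_fn_expand_column[of s]) (use assms n in \<open>simp_all\<close>)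
  then show thesis by (rule that)
qed

lemma det_fn_identical_columns:
  assumes "s < n" "t < n" "s \<noteq> t" "\<And>i. i < n \<Longrightarrow> f i s = f i t"
  shows "det_fn n f = 0"
  unfolding det_fn_def
  by (rule Determinant.det_identical_columns[of _ n s t]) (use assms in \<open>auto intro!: eq_vecI\<close>)

lemma det_fn_zero_column:
  assumes "s < n" "\<And>i. i < n \<Longrightarrow> f i s = 0"
  shows "det_fn n f = 0"
proof -
  obtain m where n: "n = Suc m" using assms by (cases n) auto
  show ?thesis unfolding n
    by (subst det_fn_expand_column[of s]) (use assms n in auto)
qed

lemma det_fn_column_add:
  assumes "s < n"
  shows "det_fn n (\<lambda>i j. if j = s then u i + v i else f i j)
    = det_fn n (\<lambda>i j. if j = s then u i else f i j) + det_fn n (\<lambda>i j. if j = s then v i else f i j)"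
proof -
  obtain C where C: "\<And>h. det_fn n (\<lambda>i j. if j = s then h i else f i j) = (\<Sum>i<n. h i * C i)"
    using det_fn_linear_in_column[OF assms, of f] by blast
  show ?thesis unfolding C by (simp add: sum.distrib ring_distribs)
qed

lemma det_fn_column_reduce:
  fixes f :: "nat \<Rightarrow> nat \<Rightarrow> 'a::comm_ring_1"
  assumes s: "s < n" and J: "\<And>j. j \<in> J \<Longrightarrow> j < n \<and> j \<noteq> s"
  shows "det_fn n (\<lambda>i j. if j = s then f i s - (\<Sum>t\<in>J. \<alpha> t * f i t) else f i j) = det_fn n f"
proof -
  obtain C where C: "\<And>h. det_fn n (\<lambda>i j. if j = s then h i else f i j) = (\<Sum>i<n. h i * C i)"
    using det_fn_linear_in_column[OF s, of f] by blast
  have z: "(\<Sum>i<n. f i t * C i) = 0" if "t \<in> J" for t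
    unfolding C[symmetric] by (rule det_fn_identical_columns[of s _ t]) (use J[OF that] s in auto)
  have "(\<Sum>i<n. (\<Sum>t\<in>J. \<alpha> t * f i t) * C i) = (\<Sum>i<n. \<Sum>t\<in>J. \<alpha> t * (f i t * C i))"
    by (simp add: sum_distrib_right mult.assoc)
  also have "\<dots> = (\<Sum>t\<in>J. \<alpha> t * (\<Sum>i<n. f i t * C i))"
    by (subst sum.swap) (simp add: sum_distrib_left)
  finally have "(\<Sum>i<n. (f i s - (\<Sum>t\<in>J. \<alpha> t * f i t)) * C i) = (\<Sum>i<n. f i s * C i)"
    using z by (simp add: left_diff_distrib sum_subtractf)
  then have "det_fn n (\<lambda>i j. if j = s then f i s - (\<Sum>t\<in>J. \<alpha> t * f i t) else f i j)
    = det_fn n (\<lambda>i j. if j = s then f i s else f i j)"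
    unfolding C .
  also have "\<dots> = det_fn n f" by (rule det_fn_cong) auto
  finally show ?thesis .
qed

lemma solve_linear_system:
  fixes f :: "nat \<Rightarrow> nat \<Rightarrow> 'a::field"
  assumes "det_fn n f \<noteq> 0"
  obtains \<alpha> where "\<And>i. i < n \<Longrightarrow> h i = (\<Sum>j<n. \<alpha> j * f i j)"
proof -
  let ?A = "Matrix.mat n n (\<lambda>(i, j). f i j)"
  obtain B where B: "B \<in> carrier_mat n n" "?A * B = 1\<^sub>m n"
    using det_non_zero_imp_unit[of ?A n] assms
    by (auto simp: Units_def ring_mat_def det_fn_def)
  let ?h = "Matrix.vec n h"
  have "?A *\<^sub>v (B *\<^sub>v ?h) = (?A * B) *\<^sub>v ?h"
    by (rule assoc_mult_mat_vec[symmetric]) (use B in auto)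
  then have eq: "?A *\<^sub>v (B *\<^sub>v ?h) = ?h"
    using B by simp
  have "h i = (\<Sum>j<n. vec_index (B *\<^sub>v ?h) j * f i j)" if "i < n" for i
  proof -
    have "h i = vec_index (?A *\<^sub>v (B *\<^sub>v ?h)) i" using that by (simp add: eq del: index_mult_mat_vec)
    also have "\<dots> = (\<Sum>j<n. f i j * vec_index (B *\<^sub>v ?h) j)"
      using that B(1) by (simp add: scalar_prod_def atLeast0LessThan)
    finally show ?thesis by (simp add: mult.commute)
  qed
  then show thesis by (rule that)
qed

lemma det_fn_mult: "det_fn n (\<lambda>i j. \<Sum>k<n. f i k * g k j) = det_fn n f * det_fn n g"
proof -
  let ?A = "Matrix.mat n n (\<lambda>(i, j). f i j)" and ?B = "Matrix.mat n n (\<lambda>(i, j). g i j)"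
  have "Matrix.mat n n (\<lambda>(i, j). \<Sum>k<n. f i k * g k j) = ?A * ?B"
    by (rule Matrix.eq_matI) (auto simp: scalar_prod_def atLeast0LessThan)
  then show ?thesis unfolding det_fn_def by (simp add: Determinant.det_mult[of _ n])
qed

lemma det_fn_upper_triangular:
  assumes "\<And>i j. j < i \<Longrightarrow> i < n \<Longrightarrow> f i j = 0"
  shows "det_fn n f = (\<Prod>i<n. f i i)"
proof -
  let ?A = "Matrix.mat n n (\<lambda>(i, j). f i j)"
  have "Determinant.det ?A = prod_list (diag_mat ?A)"
    by (rule det_upper_triangular[of _ n]) (use assms in \<open>auto simp: upper_triangular_def\<close>)
  also have "\<dots> = (\<Prod>i<n. f i i)"
    by (simp add: prod_list_diag_prod atLeast0LessThan)
  finally show ?thesis by (simp add: det_fn_def)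
qed

lemma det_fn_scale_rows: "det_fn n (\<lambda>i j. r i * f i j) = (\<Prod>i<n. r i) * det_fn n f"
proof -
  let ?d = "\<lambda>i j. if i = j then r i else 0"
  have "det_fn n (\<lambda>i j. r i * f i j) = det_fn n (\<lambda>i j. \<Sum>k<n. ?d i k * f k j)"
    by (rule det_fn_cong) (simp add: if_distrib[of "\<lambda>x. x * _"] sum.delta cong: if_cong)
  also have "\<dots> = det_fn n ?d * det_fn n f" by (rule det_fn_mult)
  also have "det_fn n ?d = (\<Prod>i<n. r i)" by (subst det_fn_upper_triangular) auto
  finally show ?thesis .
qed

text \<open>Reversal of the rows multiplies the determinant by the sign \<open>det J\<close> of the reversal, and so
  does reversal of the columns; \<open>J\<close> is an involution, so the two signs cancel.\<close>
lemma det_fn_reverse: "det_fn n (\<lambda>i j. f (n - 1 - i) (n - 1 - j)) = det_fn n f"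
proof -
  let ?J = "\<lambda>i j. if i = n - 1 - j then 1 else (0::'a)"
  have rows: "det_fn n (\<lambda>i j. h (n - 1 - i) j) = det_fn n ?J * det_fn n h" for h :: "nat \<Rightarrow> nat \<Rightarrow> 'a"
  proof -
    have "det_fn n (\<lambda>i j. h (n - 1 - i) j) = det_fn n (\<lambda>i j. \<Sum>k<n. ?J i k * h k j)"
    proof (rule det_fn_cong)
      fix i j assume ij: "i < n" "j < n"
      have "(\<Sum>k<n. ?J i k * h k j) = (\<Sum>k\<in>{n - 1 - i}. ?J i k * h k j)"
        by (rule sum.mono_neutral_right) (use ij in auto)
      then show "h (n - 1 - i) j = (\<Sum>k<n. ?J i k * h k j)" using ij by simp
    qed
    then show ?thesis by (simp only: det_fn_mult)
  qed
  have "det_fn n ?J * det_fn n ?J = det_fn n (\<lambda>i j. ?J (n - 1 - i) j)" by (rule rows[symmetric])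
  also have "\<dots> = det_fn n (\<lambda>i j. if i = j then 1 else 0)" by (rule det_fn_cong) auto
  also have "\<dots> = 1" by (subst det_fn_upper_triangular) auto
  finally have JJ: "det_fn n ?J * det_fn n ?J = 1" .
  have "det_fn n (\<lambda>i j. f (n - 1 - i) (n - 1 - j)) = det_fn n ?J * det_fn n (\<lambda>i j. f i (n - 1 - j))"
    by (rule rows)
  also have "det_fn n (\<lambda>i j. f i (n - 1 - j)) = det_fn n (\<lambda>i j. f j (n - 1 - i))"
    by (rule det_fn_transpose[symmetric])
  also have "\<dots> = det_fn n ?J * det_fn n (\<lambda>i j. f j i)" by (rule rows)
  also have "det_fn n (\<lambda>i j. f j i) = det_fn n f" by (rule det_fn_transpose)
  finally show ?thesis using JJ by (simp flip: mult.assoc)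
qed

section \<open>Condensation\<close>

lemma insert_index_0 [simp]: "insert_index 0 = Suc"
  by (auto simp: insert_index_def)

text \<open>If the first and the last column vanish outside the first and the last row, all five minors of
  the Desnanot-Jacobi identity are multiples of the middle minor \<open>M\<close> by entries at the corners.\<close>
lemma desnanot_jacobi_aux:
  fixes g :: "nat \<Rightarrow> nat \<Rightarrow> 'a::field"
  assumes "\<And>i. i < n \<Longrightarrow> g (Suc i) 0 = 0" and "\<And>i. i < n \<Longrightarrow> g (Suc i) (Suc n) = 0"
  defines "M \<equiv> det_fn n (\<lambda>i j. g (Suc i) (Suc j))"
  shows "det_fn (Suc n) g = g 0 0 * M"
    and "det_fn (Suc n) (\<lambda>i j. g (Suc i) (Suc j)) = g (Suc n) (Suc n) * M"
    and "det_fn (Suc n) (\<lambda>i j. g (Suc i) j) = (-1) ^ n * g (Suc n) 0 * M"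
    and "det_fn (Suc n) (\<lambda>i j. g i (Suc j)) = (-1) ^ n * g 0 (Suc n) * M"
    and "det_fn (Suc (Suc n)) g = (g 0 0 * g (Suc n) (Suc n) - g (Suc n) 0 * g 0 (Suc n)) * M"
proof -
  have z1: "g i 0 = 0" if "0 < i" "i < Suc n" for i using assms(1)[of "i - 1"] that by simp
  have z2: "g i (Suc n) = 0" if "0 < i" "i < Suc n" for i using assms(2)[of "i - 1"] that by simp
  show e1: "det_fn (Suc n) g = g 0 0 * M"
    by (subst det_fn_column_single[of 0 _ 0]) (auto simp: z1 M_def)
  have e2: "det_fn (Suc n) (\<lambda>i j. g (Suc i) (Suc j)) =
     (-1) ^ (n + n) * g (Suc n) (Suc n) * det_fn n (\<lambda>i j. g (Suc (insert_index n i)) (Suc (insert_index n j)))"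
    by (rule det_fn_column_single) (auto simp: assms(2))
  also have "det_fn n (\<lambda>i j. g (Suc (insert_index n i)) (Suc (insert_index n j))) = M"
    unfolding M_def by (rule det_fn_cong) auto
  finally show e2: "det_fn (Suc n) (\<lambda>i j. g (Suc i) (Suc j)) = g (Suc n) (Suc n) * M"
    by (simp add: power_add[symmetric] mult_2[symmetric])
  have "det_fn (Suc n) (\<lambda>i j. g (Suc i) j) =
     (-1) ^ (n + 0) * g (Suc n) 0 * det_fn n (\<lambda>i j. g (Suc (insert_index n i)) (insert_index 0 j))"
    by (rule det_fn_column_single) (auto simp: assms(1))
  also have "det_fn n (\<lambda>i j. g (Suc (insert_index n i)) (insert_index 0 j)) = M"
    unfolding M_def by (rule det_fn_cong) auto
  finally show "det_fn (Suc n) (\<lambda>i j. g (Suc i) j) = (-1) ^ n * g (Suc n) 0 * M" by simp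
  have "det_fn (Suc n) (\<lambda>i j. g i (Suc j)) =
     (-1) ^ (0 + n) * g 0 (Suc n) * det_fn n (\<lambda>i j. g (insert_index 0 i) (Suc (insert_index n j)))"
    by (rule det_fn_column_single) (auto simp: z2)
  also have "det_fn n (\<lambda>i j. g (insert_index 0 i) (Suc (insert_index n j))) = M"
    unfolding M_def by (rule det_fn_cong) auto
  finally show e4: "det_fn (Suc n) (\<lambda>i j. g i (Suc j)) = (-1) ^ n * g 0 (Suc n) * M" by simp
  have "det_fn (Suc (Suc n)) g = (\<Sum>r<Suc (Suc n). g r 0 * ((-1)^(r+0) *
    det_fn (Suc n) (\<lambda>i j. g (insert_index r i) (insert_index 0 j))))"
    by (rule det_fn_expand_column) simp
  also have "\<dots> = (\<Sum>r\<in>{0, Suc n}. g r 0 * ((-1)^(r+0) *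
    det_fn (Suc n) (\<lambda>i j. g (insert_index r i) (insert_index 0 j))))"
    by (rule sum.mono_neutral_right) (auto simp: z1)
  also have "\<dots> = g 0 0 * det_fn (Suc n) (\<lambda>i j. g (Suc i) (Suc j))
      - (-1) ^ n * g (Suc n) 0 * det_fn (Suc n) (\<lambda>i j. g (insert_index (Suc n) i) (Suc j))"
    by simp
  also have "det_fn (Suc n) (\<lambda>i j. g (insert_index (Suc n) i) (Suc j)) = (-1) ^ n * g 0 (Suc n) * M"
    unfolding e4[symmetric] by (rule det_fn_cong) auto
  finally show "det_fn (Suc (Suc n)) g = (g 0 0 * g (Suc n) (Suc n) - g (Suc n) 0 * g 0 (Suc n)) * M"
    unfolding e2 by (simp add: algebra_simps flip: power_add mult_2)
qed

text \<open>As the middle minor does not vanish, the middle parts of the first and of the last column are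
  combinations of the middle columns. Subtracting these combinations changes none of the minors
  and leads to the situation of the preceding lemma.\<close>
lemma desnanot_jacobi:
  fixes f :: "nat \<Rightarrow> nat \<Rightarrow> 'a::field"
  assumes nz: "det_fn n (\<lambda>i j. f (Suc i) (Suc j)) \<noteq> 0"
  shows "det_fn (Suc (Suc n)) f * det_fn n (\<lambda>i j. f (Suc i) (Suc j)) =
    det_fn (Suc n) f * det_fn (Suc n) (\<lambda>i j. f (Suc i) (Suc j))
    - det_fn (Suc n) (\<lambda>i j. f (Suc i) j) * det_fn (Suc n) (\<lambda>i j. f i (Suc j))"
proof -
  obtain \<alpha> where \<alpha>: "\<And>i. i < n \<Longrightarrow> f (Suc i) 0 = (\<Sum>j<n. \<alpha> j * f (Suc i) (Suc j))"
    using solve_linear_system[OF nz, of "\<lambda>i. f (Suc i) 0"] by blast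
  obtain \<beta> where \<beta>: "\<And>i. i < n \<Longrightarrow> f (Suc i) (Suc n) = (\<Sum>j<n. \<beta> j * f (Suc i) (Suc j))"
    using solve_linear_system[OF nz, of "\<lambda>i. f (Suc i) (Suc n)"] by blast
  define g1 where "g1 i j = (if j = 0 then f i 0 - (\<Sum>t\<in>{1..n}. \<alpha> (t - 1) * f i t) else f i j)" for i j
  define g where "g i j = (if j = Suc n then f i (Suc n) - (\<Sum>t\<in>{1..n}. \<beta> (t - 1) * f i t) else g1 i j)" for i j
  have sh: "(\<Sum>t\<in>{1..n}. h (t - 1) t) = (\<Sum>j<n. h j (Suc j))" for h :: "nat \<Rightarrow> nat \<Rightarrow> 'a"
    by (rule sum.reindex_bij_witness[of _ Suc "\<lambda>t. t - 1"]) auto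
  have mid: "g i (Suc j) = f i (Suc j)" if "j < n" for i j using that by (simp add: g_def g1_def)
  have c0: "g i 0 = f i 0 - (\<Sum>j<n. \<alpha> j * f i (Suc j))" for i
    unfolding g_def g1_def by (simp only: sh[of "\<lambda>j t. \<alpha> j * f i t"]) simp
  have c1: "g i (Suc n) = f i (Suc n) - (\<Sum>j<n. \<beta> j * f i (Suc j))" for i
    unfolding g_def g1_def by (simp only: sh[of "\<lambda>j t. \<beta> j * f i t"]) simp
  have left: "det_fn (Suc n) (\<lambda>i j. g (r i) j) = det_fn (Suc n) (\<lambda>i j. f (r i) j)" for r
  proof -
    have "det_fn (Suc n) (\<lambda>i j. g (r i) j)
      = det_fn (Suc n) (\<lambda>i j. if j = 0 then f (r i) 0 - (\<Sum>t\<in>{1..n}. \<alpha> (t - 1) * f (r i) t) else f (r i) j)"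
      by (rule det_fn_cong) (auto simp: g_def g1_def)
    also have "\<dots> = det_fn (Suc n) (\<lambda>i j. f (r i) j)"
      by (rule det_fn_column_reduce) auto
    finally show ?thesis .
  qed
  have right: "det_fn (Suc n) (\<lambda>i j. g (r i) (Suc j)) = det_fn (Suc n) (\<lambda>i j. f (r i) (Suc j))" for r
  proof -
    have "det_fn (Suc n) (\<lambda>i j. g (r i) (Suc j))
      = det_fn (Suc n) (\<lambda>i j. if j = n then f (r i) (Suc n) - (\<Sum>t\<in>{..<n}. \<beta> t * f (r i) (Suc t)) else f (r i) (Suc j))"
      by (rule det_fn_cong) (auto simp: c1 mid)
    also have "\<dots> = det_fn (Suc n) (\<lambda>i j. f (r i) (Suc j))"
      by (rule det_fn_column_reduce[where f="\<lambda>i j. f (r i) (Suc j)"]) auto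
    finally show ?thesis .
  qed
  have "det_fn (Suc (Suc n)) g = det_fn (Suc (Suc n)) (\<lambda>i j. if j = Suc n then g1 i (Suc n) - (\<Sum>t\<in>{1..n}. \<beta> (t - 1) * g1 i t) else g1 i j)"
    by (rule det_fn_cong) (auto simp: g_def g1_def)
  also have "\<dots> = det_fn (Suc (Suc n)) g1"
    by (rule det_fn_column_reduce) auto
  also have "\<dots> = det_fn (Suc (Suc n)) f"
    unfolding g1_def by (rule det_fn_column_reduce) auto
  finally have full: "det_fn (Suc (Suc n)) g = det_fn (Suc (Suc n)) f" .
  have m: "det_fn n (\<lambda>i j. g (Suc i) (Suc j)) = det_fn n (\<lambda>i j. f (Suc i) (Suc j))"
    by (rule det_fn_cong) (simp add: mid)
  have z: "g (Suc i) 0 = 0" "g (Suc i) (Suc n) = 0" if "i < n" for i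
    using that by (simp_all add: c0 c1 \<alpha> \<beta>)
  have sq: "(-1) ^ n * ((-1) ^ n * w) = w" for w :: 'a
    by (simp flip: power_add mult_2 mult.assoc)
  define M where "M = det_fn n (\<lambda>i j. f (Suc i) (Suc j))"
  note aux = desnanot_jacobi_aux[of n g, OF z, unfolded m, folded M_def]
  have e: "det_fn (Suc (Suc n)) f = (g 0 0 * g (Suc n) (Suc n) - g (Suc n) 0 * g 0 (Suc n)) * M"
    "det_fn (Suc n) f = g 0 0 * M"
    "det_fn (Suc n) (\<lambda>i j. f (Suc i) (Suc j)) = g (Suc n) (Suc n) * M"
    "det_fn (Suc n) (\<lambda>i j. f (Suc i) j) = (-1) ^ n * g (Suc n) 0 * M"
    "det_fn (Suc n) (\<lambda>i j. f i (Suc j)) = (-1) ^ n * g 0 (Suc n) * M"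
    using aux left[of "\<lambda>i. i"] left[of Suc] right[of "\<lambda>i. i"] right[of Suc] full by simp_all
  show ?thesis
    unfolding e M_def[symmetric] by (simp add: algebra_simps sq)
qed

section \<open>A product formula by condensation\<close>

text \<open>The factors of the product formula are grouped by the linear form in \<open>x\<close> and \<open>y\<close> on which they
  depend: \<open>x + y\<close>, \<open>x - y\<close>, \<open>x + 2 y\<close>, \<open>x\<close> or \<open>y\<close>. Along the shifts \<open>(2, -1)\<close>, \<open>(1, 1)\<close>, \<open>(3, 0)\<close> of
  the condensation the forms \<open>x - y\<close> and \<open>x + 2 y\<close> only take the increments 0 and 3, so their
  groups cancel almost completely.\<close>
definition step_fact_prod :: "nat \<Rightarrow> nat \<Rightarrow> real" where
  "step_fact_prod n s = (\<Prod>j=1..n. fact (s + 2 * j))"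

definition fact_prod :: "nat \<Rightarrow> nat \<Rightarrow> real" where
  "fact_prod n y = (\<Prod>i<n. fact (y + i))"

definition diff_poch_prod :: "nat \<Rightarrow> real \<Rightarrow> real" where
  "diff_poch_prod n d = (\<Prod>j=1..n. pochhammer (d + 2 * real j + 1) (j - 1))"

definition sum_poch_prod :: "nat \<Rightarrow> real \<Rightarrow> real" where
  "sum_poch_prod n w = (\<Prod>j=1..n. pochhammer (w + 3 * real j + 1) (n - j))"

definition superfact :: "nat \<Rightarrow> real" where
  "superfact n = (\<Prod>j=1..n. fact (j - 1))"

text \<open>The value of the determinant of the array \<open>ballot_entry x y\<close>. It differs from \<open>P_prod n x y\<close> by the
  row factors \<open>x - y + 3 + 3 k\<close>, see \<open>P_prod_closed_form\<close>.\<close>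
definition closed_form :: "nat \<Rightarrow> nat \<Rightarrow> nat \<Rightarrow> real" where
  "closed_form n x y = superfact n * step_fact_prod n (x + y) * diff_poch_prod n (real x - real y) * sum_poch_prod n (real x + 2 * real y)
     / (step_fact_prod n (x + n) * fact_prod n y)"

lemma step_fact_prod_0 [simp]: "step_fact_prod 0 s = 1" and step_fact_prod_Suc: "step_fact_prod (Suc n) s = step_fact_prod n s * fact (s + 2 * n + 2)"
  by (simp_all add: step_fact_prod_def)

lemma fact_prod_0 [simp]: "fact_prod 0 s = 1" and fact_prod_Suc: "fact_prod (Suc n) s = fact_prod n s * fact (s + n)"
  by (simp_all add: fact_prod_def)

lemma diff_poch_prod_0 [simp]: "diff_poch_prod 0 s = 1"
  and diff_poch_prod_Suc: "diff_poch_prod (Suc n) d = diff_poch_prod n d * pochhammer (d + 2 * real n + 3) n"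
  by (simp_all add: diff_poch_prod_def algebra_simps)

lemma superfact_0 [simp]: "superfact 0 = 1" and superfact_Suc: "superfact (Suc n) = superfact n * fact n"
  by (simp_all add: superfact_def)

lemma step_fact_prod_pos: "step_fact_prod n s > 0" by (simp add: step_fact_prod_def prod_pos)
lemma fact_prod_pos: "fact_prod n s > 0" by (simp add: fact_prod_def prod_pos)
lemma superfact_pos: "superfact n > 0" by (simp add: superfact_def prod_pos)
lemma sum_poch_prod_pos: "w \<ge> 0 \<Longrightarrow> sum_poch_prod n w > 0"
  by (simp add: sum_poch_prod_def prod_pos pochhammer_pos)
lemma diff_poch_prod_pos: "d \<ge> -1 \<Longrightarrow> diff_poch_prod n d > 0"
  unfolding diff_poch_prod_def by (intro prod_pos ballI pochhammer_pos) auto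

lemma step_fact_prod_Suc_shift: "step_fact_prod (Suc n) s = fact (s + 2) * step_fact_prod n (s + 2)"
  by (induction n) (simp_all add: step_fact_prod_Suc add.commute add.left_commute)

text \<open>The quotient of consecutive shifts is a product of linear factors, which telescopes.\<close>
lemma step_fact_prod_four_term:
  "step_fact_prod n (s + 1) * step_fact_prod n (s + 2) * real (s + 2 * n + 3) = step_fact_prod n s * step_fact_prod n (s + 3) * real (s + 3)"
proof (induction n)
  case (Suc n)
  define u where "u = s + 2 * n + 2"
  have "step_fact_prod (Suc n) (s + 1) * step_fact_prod (Suc n) (s + 2) * real (s + 2 * Suc n + 3)
    = (step_fact_prod n (s + 1) * step_fact_prod n (s + 2) * real (s + 2 * n + 3)) * (fact u * fact (u + 3))"
  proof -
    have "fact (s + 1 + 2 * n + 2) = real (s + 2 * n + 3) * fact u"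
      using fact_Suc[of u, where 'a=real] by (simp add: u_def algebra_simps)
    moreover have "fact (u + 3) = real (s + 2 * Suc n + 3) * fact (s + 2 + 2 * n + 2)"
      using fact_Suc[of "u + 2", where 'a=real] by (simp add: u_def algebra_simps eval_nat_numeral)
    ultimately show ?thesis by (simp add: step_fact_prod_Suc)
  qed
  also have "\<dots> = step_fact_prod n s * step_fact_prod n (s + 3) * real (s + 3) * (fact u * fact (u + 3))"
    by (simp only: Suc.IH)
  also have "\<dots> = step_fact_prod (Suc n) s * step_fact_prod (Suc n) (s + 3) * real (s + 3)"
    by (simp add: step_fact_prod_Suc u_def add.commute add.left_commute)
  finally show ?case .
qed simp

lemma fact_prod_shift: "fact_prod n (Suc y) * fact y = fact_prod n y * fact (y + n)"
  by (induction n) (simp_all add: fact_prod_Suc mult_ac)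

lemma fact_prod_three_term:
  "fact_prod n y * fact_prod n (y + 2) * real (y + 1) = fact_prod n (y + 1) ^ 2 * real (y + n + 1)"
proof -
  have "fact y * fact (y+1) * (fact_prod n y * fact_prod n (y + 2) * real (y + 1))
     = fact y * fact_prod n y * (fact_prod n (Suc (Suc y)) * fact (Suc y)) * real (y+1)" by simp
  also have "\<dots> = fact y * fact_prod n y * (fact_prod n (Suc y) * fact (Suc y + n)) * real (y+1)"
    by (simp only: fact_prod_shift)
  also have "\<dots> = fact_prod n (Suc y) * (fact_prod n y * fact (y + n)) * real (y + n + 1) * (fact y * real (y+1))"
    by simp
  also have "\<dots> = fact_prod n (Suc y) * (fact_prod n (Suc y) * fact y) * real (y + n + 1) * fact (y+1)"
    by (simp only: fact_prod_shift) simp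
  also have "\<dots> = fact y * fact (y+1) * (fact_prod n (y + 1) ^ 2 * real (y + n + 1))"
    by (simp add: power2_eq_square)
  finally show ?thesis by (simp del: fact_Suc)
qed

lemma sum_poch_prod_Suc: "sum_poch_prod (Suc n) w = sum_poch_prod n w * (\<Prod>j=1..n. w + 2 * real j + real n + 1)"
proof -
  have "sum_poch_prod (Suc n) w = (\<Prod>j=1..n. pochhammer (w + 3 * real j + 1) (Suc n - j))"
    by (simp add: sum_poch_prod_def)
  also have "\<dots> = (\<Prod>j=1..n. pochhammer (w + 3 * real j + 1) (n - j) * (w + 2 * real j + real n + 1))"
    by (intro prod.cong refl) (simp add: Suc_diff_le pochhammer_Suc of_nat_diff algebra_simps)
  finally show ?thesis by (simp add: prod.distrib sum_poch_prod_def)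
qed

lemma sum_poch_prod_condense:
  "sum_poch_prod (Suc (Suc n)) w * sum_poch_prod n (w + 3) = (w + real n + 4) * (sum_poch_prod (Suc n) w * sum_poch_prod (Suc n) (w + 3))"
proof -
  have "(\<Prod>j=1..Suc n. w + 2 * real j + real (Suc n) + 1)
    = (w + real n + 4) * (\<Prod>j=1..n. w + 2 * real (Suc j) + real (Suc n) + 1)"
    by (subst prod.atLeast_Suc_atMost)
       (simp_all add: prod.atLeast_Suc_atMost_Suc_shift algebra_simps del: prod.cl_ivl_Suc)
  also have "(\<Prod>j=1..n. w + 2 * real (Suc j) + real (Suc n) + 1) = (\<Prod>j=1..n. (w + 3) + 2 * real j + real n + 1)"
    by (intro prod.cong) auto
  finally show ?thesis by (simp add: sum_poch_prod_Suc[of "Suc n" w] sum_poch_prod_Suc[of n "w + 3"])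
qed

lemma diff_poch_prod_condense:
  "diff_poch_prod (Suc (Suc n)) d * diff_poch_prod n (d + 3) = (d + 2 * real n + 5) * (diff_poch_prod (Suc n) d * diff_poch_prod (Suc n) (d + 3))"
  by (simp add: diff_poch_prod_Suc[of "Suc n"] diff_poch_prod_Suc[of n "d + 3"] pochhammer_rec algebra_simps)

lemma step_fact_prod_condense:
  "step_fact_prod (Suc (Suc n)) s * step_fact_prod n (s + 3) * real (s + 2 * n + 5) = step_fact_prod (Suc n) s * step_fact_prod (Suc n) (s + 3)"
proof -
  have "fact (s + 3 + 2 * n + 2) = real (s + 2 * n + 5) * fact (s + 2 * n + 4)"
  proof -
    have "s + 3 + 2 * n + 2 = Suc (s + 2 * n + 4)" by simp
    then show ?thesis using fact_Suc[of "s + 2 * n + 4", where 'a=real] by (simp only:) simp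
  qed
  moreover have "s + 2 * Suc n + 2 = s + 2 * n + 4" by simp
  ultimately show ?thesis by (simp only: step_fact_prod_Suc mult_ac)
qed

lemma step_fact_prod_condense':
  "step_fact_prod (Suc (Suc n)) (x + Suc (Suc n)) * step_fact_prod n (x + 3 + n)
    = real (x + n + 4) * (step_fact_prod (Suc n) (x + Suc n) * step_fact_prod (Suc n) (x + 3 + Suc n))"
proof -
  have "step_fact_prod (Suc (Suc n)) (x + n + 2) = fact (x + n + 4) * step_fact_prod (Suc n) (x + n + 4)"
    using step_fact_prod_Suc_shift[of "Suc n" "x + n + 2"] by (simp add: eval_nat_numeral)
  moreover have "step_fact_prod (Suc n) (x + n + 1) = fact (x + n + 3) * step_fact_prod n (x + n + 3)"
    using step_fact_prod_Suc_shift[of "n" "x + n + 1"] by (simp add: eval_nat_numeral)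
  moreover have "fact (x + n + 4) = real (x + n + 4) * fact (x + n + 3)"
    using fact_Suc[of "x + n + 3", where 'a=real] by (simp add: eval_nat_numeral)
  moreover have "x + Suc (Suc n) = x + n + 2" "x + 3 + n = x + n + 3" "x + Suc n = x + n + 1" "x + 3 + Suc n = x + n + 4"
    by simp_all
  ultimately show ?thesis by (simp only: mult_ac)
qed

lemma superfact_condense: "superfact (Suc (Suc n)) * superfact n = real (n + 1) * superfact (Suc n) ^ 2"
  by (simp add: superfact_Suc power2_eq_square algebra_simps)

lemma fact_prod_condense: "fact_prod (Suc (Suc n)) y * fact_prod n y = real (y + n + 1) * fact_prod (Suc n) y ^ 2"
  by (simp add: fact_prod_Suc power2_eq_square algebra_simps)

lemma closed_form_pos:
  assumes "y \<le> x + 1"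
  shows "closed_form n x y > 0"
  unfolding closed_form_def using assms
  by (intro divide_pos_pos mult_pos_pos step_fact_prod_pos fact_prod_pos superfact_pos sum_poch_prod_pos diff_poch_prod_pos) auto

text \<open>The left-hand side of the condensation recurrence and the first product on its right-hand
  side, compared.\<close>
lemma closed_form_outer:
  "closed_form (Suc (Suc n)) x y * closed_form n (x + 3) y * (real (x + y + 2 * n + 5) * real (x + n + 4) * real (y + n + 1))
   = closed_form (Suc n) x y * closed_form (Suc n) (x + 3) y *
     (real (n + 1) * (real x - real y + 2 * real n + 5) * (real x + 2 * real y + real n + 4))"
proof -
  note pos = step_fact_prod_pos[THEN less_imp_neq, THEN not_sym] fact_prod_pos[THEN less_imp_neq, THEN not_sym]
  define C F E K X Y where "C = superfact (Suc n) ^ 2" and "F = step_fact_prod (Suc (Suc n)) (x + y) * step_fact_prod n (x + 3 + y)"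
    and "E = diff_poch_prod (Suc n) (real x - real y) * diff_poch_prod (Suc n) (real x - real y + 3)"
    and "K = sum_poch_prod (Suc n) (real x + 2 * real y) * sum_poch_prod (Suc n) (real x + 2 * real y + 3)"
    and "X = step_fact_prod (Suc n) (x + Suc n) * step_fact_prod (Suc n) (x + 3 + Suc n)"
    and "Y = fact_prod (Suc n) y ^ 2"
  have XY: "X \<noteq> 0" "Y \<noteq> 0" by (simp_all add: X_def Y_def pos)
  have a: "real (x + 3) - real y = real x - real y + 3" "real (x + 3) + 2 * real y = real x + 2 * real y + 3" by simp_all
  have "closed_form (Suc (Suc n)) x y * closed_form n (x + 3) y =
     (superfact (Suc (Suc n)) * superfact n) * F
     * (diff_poch_prod (Suc (Suc n)) (real x - real y) * diff_poch_prod n (real x - real y + 3))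
     * (sum_poch_prod (Suc (Suc n)) (real x + 2 * real y) * sum_poch_prod n (real x + 2 * real y + 3))
     / ((step_fact_prod (Suc (Suc n)) (x + Suc (Suc n)) * step_fact_prod n (x + 3 + n)) * (fact_prod (Suc (Suc n)) y * fact_prod n y))"
    unfolding closed_form_def a F_def by (simp only: times_divide_times_eq mult_ac)
  also have "\<dots> = (real (n+1) * C) * F * ((real x - real y + 2 * real n + 5) * E)
     * ((real x + 2 * real y + real n + 4) * K) / ((real (x + n + 4) * X) * (real (y + n + 1) * Y))"
    by (simp only: superfact_condense diff_poch_prod_condense sum_poch_prod_condense step_fact_prod_condense' fact_prod_condense
        C_def E_def K_def X_def Y_def)
  finally have 1: "closed_form (Suc (Suc n)) x y * closed_form n (x + 3) y = \<dots>" .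
  have F2: "step_fact_prod (Suc n) (x + y) * step_fact_prod (Suc n) (x + 3 + y) = F * real (x + y + 2 * n + 5)"
  proof -
    have "x + 3 + y = x + y + 3" by simp
    then show ?thesis using step_fact_prod_condense[of n "x + y"] by (simp only: F_def)
  qed
  have "closed_form (Suc n) x y * closed_form (Suc n) (x + 3) y =
      C * (step_fact_prod (Suc n) (x + y) * step_fact_prod (Suc n) (x + 3 + y)) * E * K / (X * Y)"
    unfolding closed_form_def a C_def E_def K_def X_def Y_def
    by (simp only: times_divide_times_eq mult_ac power2_eq_square)
  then have 2: "closed_form (Suc n) x y * closed_form (Suc n) (x + 3) y = C * (F * real (x + y + 2 * n + 5)) * E * K / (X * Y)"
    by (simp only: F2)
  have "real (x + n + 4) \<noteq> 0" "real (y + n + 1) \<noteq> 0" by simp_all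
  then show ?thesis unfolding 1 2 using XY
    by (simp add: divide_simps del: of_nat_add)
qed

text \<open>The second product on the right-hand side of the condensation recurrence, compared with the first.
  The variable \<open>y\<close> is shifted by one so that its predecessor is a natural number.\<close>
lemma closed_form_inner:
  "closed_form (Suc n) (x + 2) y * closed_form (Suc n) (x + 1) (y + 2) * (real (x + y + 2 * n + 6) * real (x + n + 4) * real (y + n + 2))
   = closed_form (Suc n) x (y + 1) * closed_form (Suc n) (x + 3) (y + 1) *
     (real (x + y + 4) * real (x + 3 * n + 6) * real (y + 1))"
proof -
  note pos = step_fact_prod_pos[THEN less_imp_neq, THEN not_sym] fact_prod_pos[THEN less_imp_neq, THEN not_sym]
  define m where "m = Suc n"
  define R where "R = superfact m ^ 2 * (diff_poch_prod m (real x - real y - 1) * diff_poch_prod m (real x - real y + 2))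
     * (sum_poch_prod m (real x + 2 * real y + 2) * sum_poch_prod m (real x + 2 * real y + 5))"
  define s where "s = x + (y + 1)"
  define t where "t = x + m"
  have e1: "real (x + 2) - real y = real x - real y + 2" "real (x + 1) - real (y + 2) = real x - real y - 1"
    "real (x + 2) + 2 * real y = real x + 2 * real y + 2" "real (x + 1) + 2 * real (y + 2) = real x + 2 * real y + 5"
    "real x - real (y + 1) = real x - real y - 1" "real (x + 3) - real (y + 1) = real x - real y + 2"
    "real x + 2 * real (y + 1) = real x + 2 * real y + 2" "real (x + 3) + 2 * real (y + 1) = real x + 2 * real y + 5"
    by simp_all
  have e2: "x + 2 + y = s + 1" "x + 1 + (y + 2) = s + 2" "x + 3 + (y + 1) = s + 3" "x + (y + 1) = s"
     "x + 2 + m = t + 2" "x + 1 + m = t + 1" "x + 3 + m = t + 3" "x + m = t"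
    by (simp_all add: s_def t_def)
  have 1: "closed_form m (x + 2) y * closed_form m (x + 1) (y + 2) =
     R * (step_fact_prod m (s + 1) * step_fact_prod m (s + 2)) / ((step_fact_prod m (t + 1) * step_fact_prod m (t + 2)) * (fact_prod m y * fact_prod m (y + 2)))"
    unfolding closed_form_def e1 e2 R_def by (simp only: times_divide_times_eq mult_ac power2_eq_square)
  have 2: "closed_form m x (y + 1) * closed_form m (x + 3) (y + 1) =
     R * (step_fact_prod m s * step_fact_prod m (s + 3)) / ((step_fact_prod m t * step_fact_prod m (t + 3)) * (fact_prod m (y + 1) ^ 2))"
    unfolding closed_form_def e1 e2 R_def by (simp only: times_divide_times_eq mult_ac power2_eq_square)
  note f1 = step_fact_prod_four_term[of m s] and f2 = step_fact_prod_four_term[of m t] and f3 = fact_prod_three_term[of m y]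
  have a: "real (x + y + 2 * n + 6) = real (s + 2 * m + 3)" "real (x + n + 4) = real (t + 3)" "real (y + n + 2) = real (y + m + 1)"
    "real (x + y + 4) = real (s + 3)" "real (x + 3 * n + 6) = real (t + 2 * m + 3)"
    by (simp_all add: s_def t_def m_def)
  define f12 f03 t12 t03 y02 y1 where "f12 = step_fact_prod m (s + 1) * step_fact_prod m (s + 2)" and "f03 = step_fact_prod m s * step_fact_prod m (s + 3)"
    and "t12 = step_fact_prod m (t + 1) * step_fact_prod m (t + 2)" and "t03 = step_fact_prod m t * step_fact_prod m (t + 3)"
    and "y02 = fact_prod m y * fact_prod m (y + 2)" and "y1 = fact_prod m (y + 1) ^ 2"
  have nz: "t12 \<noteq> 0" "t03 \<noteq> 0" "y02 \<noteq> 0" "y1 \<noteq> 0" by (simp_all add: t12_def t03_def y02_def y1_def pos)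
  have "R * f12 / (t12 * y02) * (real (s + 2 * m + 3) * real (t + 3) * real (y + m + 1))
    = R * f03 / (t03 * y1) * (real (s + 3) * real (t + 2 * m + 3) * real (y + 1))"
  proof -
    have g: "f12 * real (s + 2 * m + 3) = f03 * real (s + 3)" "t12 * real (t + 2 * m + 3) = t03 * real (t + 3)"
      "y02 * real (y + 1) = y1 * real (y + m + 1)"
      using f1 f2 f3 by (simp_all only: f12_def f03_def t12_def t03_def y02_def y1_def)
    have "R * f12 * (real (s + 2 * m + 3) * real (t + 3) * real (y + m + 1)) * (t03 * y1)
       = R * (f12 * real (s + 2 * m + 3)) * (t03 * real (t + 3)) * (y1 * real (y + m + 1))"
      by (simp only: mult_ac)
    also have "\<dots> = R * (f03 * real (s + 3)) * (t12 * real (t + 2 * m + 3)) * (y02 * real (y + 1))"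
      by (simp only: g)
    also have "\<dots> = R * f03 * (real (s + 3) * real (t + 2 * m + 3) * real (y + 1)) * (t12 * y02)"
      by (simp only: mult_ac)
    finally show ?thesis using nz by (simp add: divide_simps del: of_nat_add)
  qed
  then show ?thesis unfolding a m_def[symmetric] 1 2
    by (simp only: f12_def f03_def t12_def t03_def y02_def y1_def)
qed

text \<open>The entry is the factorial quotient with the convention that \<open>1 / (y + j - k)!\<close> is zero for a
  negative argument.\<close>
definition ballot_entry :: "nat \<Rightarrow> nat \<Rightarrow> nat \<Rightarrow> nat \<Rightarrow> real" where
  "ballot_entry x y k j = (if y + j < k then 0 else
     fact (x + y + 2 + k + 2 * j) / (fact (y + j - k) * fact (x + 2 * k + j + 3)))"

lemma ballot_entry_shift:
  "ballot_entry x y (Suc k) (Suc j) = ballot_entry (x + 3) y k j"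
  "ballot_entry x (Suc y) (Suc k) j = ballot_entry (x + 2) y k j"
  "ballot_entry x y k (Suc j) = ballot_entry (x + 1) (y + 1) k j"
proof -
  have a: "x + y + 2 + Suc k + 2 * Suc j = x + 3 + y + 2 + k + 2 * j" "x + 2 * Suc k + Suc j + 3 = x + 3 + 2 * k + j + 3"
   "x + Suc y + 2 + Suc k + 2 * j = x + 2 + y + 2 + k + 2 * j" "x + 2 * Suc k + j + 3 = x + 2 + 2 * k + j + 3"
   "x + y + 2 + k + 2 * Suc j = x + 1 + (y + 1) + 2 + k + 2 * j" "x + 2 * k + Suc j + 3 = x + 1 + 2 * k + j + 3" by simp_all
  show "ballot_entry x y (Suc k) (Suc j) = ballot_entry (x + 3) y k j" "ballot_entry x (Suc y) (Suc k) j = ballot_entry (x + 2) y k j"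
    "ballot_entry x y k (Suc j) = ballot_entry (x + 1) (y + 1) k j"
    unfolding ballot_entry_def a by (simp_all del: fact_Suc add: not_less_eq)
qed

text \<open>What remains of the recurrence for the product formula when all common factors are
  divided out.\<close>
lemma polynomial_identity:
  fixes n x y :: real
  shows "(n + 1) * (x - y + 2 * n + 5) * (x + 2 * y + n + 4)
    = (x + y + 2 * n + 5) * (x + n + 4) * (y + n + 1) - (x + y + 3) * (x + 3 * n + 6) * y"
  by (simp add: algebra_simps)

text \<open>Condensation. The hypothesis is stable under all shifts that occur, because each of them changes
  \<open>x - y\<close> by 0 or 3, and it makes the product formula positive, so that the middle minor
  may be cancelled.\<close>
lemma det_ballot_entry:
  assumes "y \<le> x + 1"
  shows "det_fn n (ballot_entry x y) = closed_form n x y"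
  using assms
proof (induction n arbitrary: x y rule: less_induct)
  case (less n)
  consider "n = 0" | "n = 1" | N where "n = Suc (Suc N)"
    by (metis One_nat_def not0_implies_Suc)
  then show ?case
  proof cases
    case 1
    then show ?thesis by (simp add: closed_form_def sum_poch_prod_def)
  next
    case 2
    have "det_fn (Suc 0) (ballot_entry x y) = ballot_entry x y 0 0"
      by (subst det_fn_expand_column[of 0]) simp_all
    also have "\<dots> = closed_form (Suc 0) x y"
    proof -
      have "x + y + 2 * 1 = x + y + 2" "x + 1 + 2 * 1 = x + 3" "Suc (Suc (Suc x)) = x + 3" by simp_all
      then show ?thesis by (simp add: closed_form_def sum_poch_prod_def ballot_entry_def step_fact_prod_def fact_prod_def diff_poch_prod_def superfact_def mult.commute del: fact_Suc)
        (simp add: numeral_3_eq_3 del: fact_Suc)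
    qed
    finally show ?thesis using 2 by simp
  next
    case 3
    have IH0: "det_fn N (\<lambda>k j. ballot_entry x y (Suc k) (Suc j)) = closed_form N (x + 3) y"
      using less.IH[of N y "x + 3"] less.prems 3 unfolding ballot_entry_shift(1) by simp
    have IH1: "det_fn (Suc N) (ballot_entry x y) = closed_form (Suc N) x y"
      using less.IH[of "Suc N" y x] less.prems 3 by simp
    have IH2: "det_fn (Suc N) (\<lambda>k j. ballot_entry x y (Suc k) (Suc j)) = closed_form (Suc N) (x + 3) y"
      using less.IH[of "Suc N" y "x + 3"] less.prems 3 unfolding ballot_entry_shift(1) by simp
    have IH3: "det_fn (Suc N) (\<lambda>k j. ballot_entry x y k (Suc j)) = closed_form (Suc N) (x + 1) (y + 1)"
      using less.IH[of "Suc N" "y + 1" "x + 1"] less.prems 3 unfolding ballot_entry_shift(3) by simp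
    have pos: "closed_form N (x + 3) y > 0" by (rule closed_form_pos) (use less.prems in simp)
    let ?S = "real (x + y + 2 * N + 5) * real (x + N + 4) * real (y + N + 1)"
    let ?T = "closed_form (Suc N) x y * closed_form (Suc N) (x + 3) y"
    have S: "?S > 0" by simp
    \<comment> \<open>For \<open>y = 0\<close> the shift \<open>(2, -1)\<close> leaves the natural numbers, but then the minor has a zero column
      and the factor \<open>y\<close> on the right vanishes as well.\<close>
    have IH4: "det_fn (Suc N) (\<lambda>k j. ballot_entry x y (Suc k) j) * closed_form (Suc N) (x + 1) (y + 1) * ?S
      = ?T * (real (x + y + 3) * real (x + 3 * N + 6) * real y)"
    proof (cases y)
      case 0
      have "det_fn (Suc N) (\<lambda>k j. ballot_entry x y (Suc k) j) = 0"
        by (rule det_fn_zero_column[of 0]) (simp_all add: 0 ballot_entry_def)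
      then show ?thesis using 0 by simp
    next
      case (Suc z)
      have "det_fn (Suc N) (\<lambda>k j. ballot_entry x y (Suc k) j) = closed_form (Suc N) (x + 2) z"
        using less.IH[of "Suc N" z "x + 2"] less.prems 3
        by (simp only: Suc ballot_entry_shift(2))
      moreover have "y = z + 1" "x + y + 2 * N + 5 = x + z + 2 * N + 6" "y + N + 1 = z + N + 2" "x + y + 3 = x + z + 4"
        "y + 1 = z + 2" using Suc by simp_all
      ultimately show ?thesis using closed_form_inner[of N x z] by (simp only:)
    qed
    have "det_fn (Suc (Suc N)) (ballot_entry x y) * closed_form N (x + 3) y =
       ?T - det_fn (Suc N) (\<lambda>k j. ballot_entry x y (Suc k) j) * closed_form (Suc N) (x + 1) (y + 1)"
      using desnanot_jacobi[of N "ballot_entry x y"] pos by (simp only: IH0 IH1 IH2 IH3)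
    then have "det_fn (Suc (Suc N)) (ballot_entry x y) * closed_form N (x + 3) y * ?S =
       ?T * ?S - det_fn (Suc N) (\<lambda>k j. ballot_entry x y (Suc k) j) * closed_form (Suc N) (x + 1) (y + 1) * ?S"
      by (simp only: left_diff_distrib)
    also have "\<dots> = ?T * ?S - ?T * (real (x + y + 3) * real (x + 3 * N + 6) * real y)"
      by (simp only: IH4)
    also have "\<dots> = ?T * (real (N + 1) * (real x - real y + 2 * real N + 5) * (real x + 2 * real y + real N + 4))"
    proof -
      have "real (N + 1) * (real x - real y + 2 * real N + 5) * (real x + 2 * real y + real N + 4)
        = ?S - real (x + y + 3) * real (x + 3 * N + 6) * real y"
        using polynomial_identity[of "real N" "real x" "real y"] by (simp add: add_ac)
      then show ?thesis by (simp only: right_diff_distrib)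
    qed
    also have "\<dots> = closed_form (Suc (Suc N)) x y * closed_form N (x + 3) y * ?S"
      by (rule closed_form_outer[symmetric])
    finally show ?thesis using pos S 3 by simp
  qed
qed

section \<open>Differences of binomial coefficients\<close>

text \<open>Binomial coefficients that vanish at negative lower index satisfy Pascal's recurrence without
  side conditions.\<close>
definition int_choose :: "nat \<Rightarrow> int \<Rightarrow> real" where
  "int_choose n z = (if z < 0 then 0 else real (n choose nat z))"

lemma int_choose_neg: "z < 0 \<Longrightarrow> int_choose n z = 0" by (simp add: int_choose_def)
lemma int_choose_big: "int n < z \<Longrightarrow> int_choose n z = 0" by (simp add: int_choose_def)

lemma int_choose_Suc: "int_choose (Suc n) z = int_choose n z + int_choose n (z - 1)"
proof (cases "z > 0")
  case True
  define m where "m = nat (z - 1)"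
  have "nat z = Suc m" "nat (z - 1) = m" using True by (simp_all add: m_def)
  then show ?thesis using True by (simp add: int_choose_def)
next
  case False
  then show ?thesis by (cases "z = 0") (auto simp: int_choose_def)
qed

text \<open>The ballot theorem: reflection at distance one gives a single quotient of factorials.\<close>
lemma int_choose_ballot:
  assumes "q > 0"
  shows "int_choose (p + q - 1) (int p) - int_choose (p + q - 1) (int p - 1)
    = (real q - real p) * fact (p + q - 1) / (fact p * fact q)"
proof (cases p)
  case 0
  then show ?thesis using assms by (simp add: int_choose_def fact_reduce[of q])
next
  case (Suc r)
  obtain s where q: "q = Suc s" using assms gr0_implies_Suc by auto
  have 1: "real (p + q - 1 choose p) = fact (p + q - 1) / (fact p * fact s)"
    using q by (subst binomial_fact) auto
  have 2: "real (p + q - 1 choose r) = fact (p + q - 1) / (fact r * fact q)"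
    using q Suc by (subst binomial_fact) auto
  have alg: "F / ((m * u) * v) - F / (u * (l * v)) = (l - m) * F / ((m * u) * (l * v))"
    if "u \<noteq> 0" "v \<noteq> 0" "l \<noteq> 0" "m \<noteq> 0" for F u v l m :: real
    using that by (simp add: field_simps)
  have fp: "fact p = real p * fact r" and fq: "fact q = real q * fact s"
    by (simp_all add: Suc q)
  have "int p - 1 = int r" by (simp add: Suc)
  then have "int_choose (p + q - 1) (int p) - int_choose (p + q - 1) (int p - 1) = real (p + q - 1 choose p) - real (p + q - 1 choose r)"
    by (simp only: int_choose_def nat_int) simp
  also have "\<dots> = fact (p + q - 1) / ((real p * fact r) * fact s) - fact (p + q - 1) / (fact r * (real q * fact s))"
    unfolding 1 2 by (simp only: fp fq)
  also have "\<dots> = (real q - real p) * fact (p + q - 1) / (fact p * fact q)"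
    unfolding fp fq by (rule alg) (use Suc q in simp_all)
  finally show ?thesis .
qed

text \<open>These are the coefficients of \<open>(z + 2 + 1/z)^j (z - 1/z)\<close> with respect to the odd Laurent
  polynomials \<open>z^(i+1) - z^(-i-1)\<close>.\<close>
fun column_coeff :: "nat \<Rightarrow> nat \<Rightarrow> real" where
  "column_coeff 0 i = (if i = 0 then 1 else 0)"
| "column_coeff (Suc j) i = (if i = 0 then 0 else column_coeff j (i - 1)) + 2 * column_coeff j i + column_coeff j (Suc i)"

lemma column_coeff_above: "j < i \<Longrightarrow> column_coeff j i = 0"
  by (induction j arbitrary: i) auto

lemma column_coeff_diag: "column_coeff j j = 1"
  by (induction j) (simp_all add: column_coeff_above)

definition choose_diff :: "nat \<Rightarrow> int \<Rightarrow> nat \<Rightarrow> real" where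
  "choose_diff n m l = int_choose n (m + int l) - int_choose n (m - int l)"

lemma choose_diff_0: "choose_diff n m 0 = 0" by (simp add: choose_diff_def)

lemma choose_diff_step: "choose_diff (Suc (Suc n)) (m + 1) (Suc i) = choose_diff n m (Suc (Suc i)) + 2 * choose_diff n m (Suc i) + choose_diff n m i"
  by (simp add: choose_diff_def int_choose_Suc algebra_simps)

text \<open>Two applications of Pascal's recurrence act on the row \<open>n\<close> as multiplication by \<open>z + 2 + 1/z\<close>,
  and \<open>choose_diff n m l\<close> is the coefficient functional evaluated at \<open>z^l - z^(-l)\<close>.\<close>
lemma choose_diff_expand:
  "choose_diff (n + 2 * j) (m + int j) 1 = (\<Sum>i\<le>j. choose_diff n m (Suc i) * column_coeff j i)"
proof (induction j arbitrary: n m)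
  case (Suc j)
  have "choose_diff (n + 2 * Suc j) (m + int (Suc j)) 1 = choose_diff (Suc (Suc n) + 2 * j) ((m + 1) + int j) 1"
    by (simp add: algebra_simps)
  also have "\<dots> = (\<Sum>i\<le>j. choose_diff (Suc (Suc n)) (m + 1) (Suc i) * column_coeff j i)"
    by (rule Suc.IH)
  also have "\<dots> = (\<Sum>i\<le>j. choose_diff n m (Suc (Suc i)) * column_coeff j i) + 2 * (\<Sum>i\<le>j. choose_diff n m (Suc i) * column_coeff j i)
      + (\<Sum>i\<le>j. choose_diff n m i * column_coeff j i)"
    by (simp add: choose_diff_step ring_distribs sum.distrib sum_distrib_left mult.assoc)
  also have "(\<Sum>i\<le>j. choose_diff n m (Suc (Suc i)) * column_coeff j i) = (\<Sum>i\<le>Suc j. choose_diff n m (Suc i) * (if i = 0 then 0 else column_coeff j (i - 1)))"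
    by (subst sum.atMost_Suc_shift) simp
  also have "(\<Sum>i\<le>j. choose_diff n m (Suc i) * column_coeff j i) = (\<Sum>i\<le>Suc j. choose_diff n m (Suc i) * column_coeff j i)"
    by (simp add: column_coeff_above)
  also have "(\<Sum>i\<le>j. choose_diff n m i * column_coeff j i) = (\<Sum>i\<le>Suc (Suc j). choose_diff n m i * column_coeff j i)"
    by (simp add: column_coeff_above)
  also have "\<dots> = (\<Sum>i\<le>Suc j. choose_diff n m (Suc i) * column_coeff j (Suc i))"
    by (subst sum.atMost_Suc_shift) (simp add: choose_diff_0)
  finally show ?case
    by (simp only: column_coeff.simps distrib_left sum.distrib sum_distrib_left mult_ac)
qed simp

lemma choose_diff_1_ballot_entry:
  assumes "N = x + y + 1 + k + 2 * j" "M = int y - int k - 1 + int j"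
  shows "choose_diff N M 1 = (real x - real y + 3 + 3 * real k) * ballot_entry x y k j"
proof -
  have g: "choose_diff N M 1 = int_choose (Suc N) (M + 1) - int_choose (Suc N) M"
    by (simp add: choose_diff_def int_choose_Suc)
  show ?thesis
  proof (cases "y + j < k")
    case True
    then show ?thesis unfolding g using assms by (simp add: ballot_entry_def int_choose_neg)
  next
    case False
    define p where "p = y + j - k"
    define q where "q = x + 2 * k + j + 3"
    have "M + 1 = int p" "M = int p - 1" using False assms by (simp_all add: p_def)
    moreover have n: "Suc N = p + q - 1" using False assms by (simp add: p_def q_def)
    ultimately have "choose_diff N M 1 = int_choose (p + q - 1) (int p) - int_choose (p + q - 1) (int p - 1)"
      unfolding g by simp
    also have "\<dots> = (real q - real p) * fact (p + q - 1) / (fact p * fact q)"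
      by (rule int_choose_ballot) (simp add: q_def)
    also have "real q - real p = real x - real y + 3 + 3 * real k"
      using False by (simp add: p_def q_def of_nat_diff)
    also have "p + q - 1 = x + y + 2 + k + 2 * j" using n assms by simp
    finally show ?thesis using False by (simp add: ballot_entry_def p_def q_def)
  qed
qed

lemma P_prod_closed_form:
  "P_prod n x y = (\<Prod>k<n. real x - real y + 3 + 3 * real k) * closed_form n x y"
proof -
  have y: "fact_prod n y = (\<Prod>j=1..n. fact (y + n - j))"
    unfolding fact_prod_def by (rule prod.reindex_bij_witness[of _ "\<lambda>j. n - j" "\<lambda>i. n - i"]) auto
  have l: "(\<Prod>k<n. real x - real y + 3 + 3 * real k) = (\<Prod>j=1..n. real x - real y + 3 * real j)"
    by (rule prod.reindex_bij_witness[of _ "\<lambda>j. j - 1" Suc]) (auto simp: of_nat_diff)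
  have "P_prod n x y = (\<Prod>j=1..n. (real x - real y + 3 * real j) *
      (fact (j - 1) * fact (x + y + 2 * j) * pochhammer (real x - real y + 2 * real j + 1) (j - 1)
        * pochhammer (real x + 2 * real y + 3 * real j + 1) (n - j)
       / (fact (x + n + 2 * j) * fact (y + n - j))))"
    unfolding P_prod_def
  proof (rule prod.cong[OF refl])
    fix j assume "j \<in> {1..n}"
    then obtain i where j: "j = Suc i" by (cases j) auto
    have "pochhammer (real x - real y + 2 * real j + 1) j
      = pochhammer (real x - real y + 2 * real j + 1) (j - 1) * (real x - real y + 3 * real j)"
      by (simp add: j pochhammer_Suc algebra_simps)
    then show "fact (j - 1) * fact (x + y + 2 * j) * pochhammer (real x - real y + 2 * real j + 1) j *
         pochhammer (real x + 2 * real y + 3 * real j + 1) (n - j) / (fact (x + n + 2 * j) * fact (y + n - j)) =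
         (real x - real y + 3 * real j) *
         (fact (j - 1) * fact (x + y + 2 * j) * pochhammer (real x - real y + 2 * real j + 1) (j - 1) *
          pochhammer (real x + 2 * real y + 3 * real j + 1) (n - j) / (fact (x + n + 2 * j) * fact (y + n - j)))"
      by (simp only: mult_ac times_divide_eq_right)
  qed
  then show ?thesis
    unfolding closed_form_def y l superfact_def step_fact_prod_def diff_poch_prod_def sum_poch_prod_def
    by (simp only: prod.distrib prod_dividef)
qed

text \<open>Reversal of rows and columns makes the distance from the wall of the \<open>j\<close>-th end equal to \<open>j + 1\<close>.
  The column operations then shift the two parameters of all entries in column \<open>j\<close> so that this
  distance becomes one.\<close>
theorem det_reflected_binomials:
  assumes "a \<ge> 1" "c \<ge> 1" "a + c \<le> b + 1"
  shows "det_fn a (\<lambda>i l. int_choose (b + c - i) (int c + int i - int l)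
      - int_choose (b + c - i) (int c + int i + int l - 2 * int a)) = P_prod a (b - a) c"
proof -
  define x where "x = b - a"
  have b: "b = x + a" "c \<le> x + 1" using assms by (simp_all add: x_def)
  let ?F = "\<lambda>i l. int_choose (b + c - i) (int c + int i - int l) - int_choose (b + c - i) (int c + int i + int l - 2 * int a)"
  define G where "G k i = choose_diff (x + c + 1 + k) (int c - int k - 1) (Suc i)" for k i
  have "det_fn a ?F = det_fn a (\<lambda>k j. ?F (a - 1 - k) (a - 1 - j))"
    by (rule det_fn_reverse[symmetric])
  also have "\<dots> = det_fn a G"
  proof (rule det_fn_cong)
    fix k j assume "k < a" "j < a"
    then have "b + c - (a - 1 - k) = x + c + 1 + k"
      "int c + int (a - 1 - k) - int (a - 1 - j) = int c - int k - 1 + int (Suc j)"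
      "int c + int (a - 1 - k) + int (a - 1 - j) - 2 * int a = int c - int k - 1 - int (Suc j)"
      using b by (simp_all add: of_nat_diff)
    then show "?F (a - 1 - k) (a - 1 - j) = G k j" by (simp only: G_def choose_diff_def)
  qed
  also have "\<dots> = det_fn a G * det_fn a (\<lambda>i j. column_coeff j i)"
    by (subst (2) det_fn_upper_triangular) (simp_all add: column_coeff_above column_coeff_diag)
  also have "\<dots> = det_fn a (\<lambda>k j. \<Sum>i<a. G k i * column_coeff j i)"
    by (rule det_fn_mult[symmetric])
  also have "\<dots> = det_fn a (\<lambda>k j. (real x - real c + 3 + 3 * real k) * ballot_entry x c k j)"
  proof (rule det_fn_cong)
    fix k j assume "k < a" "j < a"
    have "(\<Sum>i<a. G k i * column_coeff j i) = (\<Sum>i\<le>j. G k i * column_coeff j i)"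
      by (rule sum.mono_neutral_right) (use \<open>j < a\<close> in \<open>auto simp: column_coeff_above\<close>)
    also have "\<dots> = choose_diff (x + c + 1 + k + 2 * j) (int c - int k - 1 + int j) 1"
      by (simp only: G_def choose_diff_expand)
    also have "\<dots> = (real x - real c + 3 + 3 * real k) * ballot_entry x c k j"
      by (rule choose_diff_1_ballot_entry) simp_all
    finally show "(\<Sum>i<a. G k i * column_coeff j i) = \<dots>" .
  qed
  also have "\<dots> = (\<Prod>k<a. real x - real c + 3 + 3 * real k) * closed_form a x c"
    by (simp add: det_fn_scale_rows det_ballot_entry[OF b(2)])
  finally show ?thesis by (simp add: P_prod_closed_form x_def)
qed

section \<open>Affine coordinates, unit triangles and generic points\<close>

text \<open>\<open>U m n\<close> and \<open>W m n\<close> are the upward and the downward triangle of the rhombus with corners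
  \<open>(m, n)\<close>, \<open>(m + 1, n)\<close>, \<open>(m + 1, n + 1)\<close>, \<open>(m, n + 1)\<close> in affine coordinates.\<close>
datatype tri = U int int | W int int

definition pt :: "real \<Rightarrow> real \<Rightarrow> point" where
  "pt u v = u *\<^sub>R vec_e + v *\<^sub>R vec_f"

definition coord_u :: "point \<Rightarrow> real" where "coord_u p = fst p - snd p / sqrt 3"
definition coord_v :: "point \<Rightarrow> real" where "coord_v p = 2 * snd p / sqrt 3"

lemma pt_alt: "pt u v = (u + v / 2, v * sqrt 3 / 2)"
  by (simp add: pt_def vec_e_def vec_f_def)

lemma cu_pt [simp]: "coord_u (pt u v) = u" and cv_pt [simp]: "coord_v (pt u v) = v"
  by (simp_all add: coord_u_def coord_v_def pt_alt)

lemma pt_cu_cv [simp]: "pt (coord_u p) (coord_v p) = p"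
  by (simp add: coord_u_def coord_v_def pt_alt prod_eq_iff)

lemma pt_inject [simp]: "pt u v = pt u' v' \<longleftrightarrow> u = u' \<and> v = v'"
  by (metis cu_pt cv_pt)

lemma point_eq_iff: "p = q \<longleftrightarrow> coord_u p = coord_u q \<and> coord_v p = coord_v q" for p q :: point
  by (metis pt_cu_cv)

lemma cu_linear [simp]: "coord_u (p + q) = coord_u p + coord_u q" "coord_u (r *\<^sub>R p) = r * coord_u p" "coord_u (- p) = - coord_u p" "coord_u 0 = 0"
    "coord_u (p - q) = coord_u p - coord_u q"
  and cv_linear [simp]: "coord_v (p + q) = coord_v p + coord_v q" "coord_v (r *\<^sub>R p) = r * coord_v p" "coord_v (- p) = - coord_v p" "coord_v 0 = 0"
    "coord_v (p - q) = coord_v p - coord_v q"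
  by (simp_all add: coord_u_def coord_v_def algebra_simps add_divide_distrib diff_divide_distrib)

lemma cu_vec [simp]: "coord_u vec_e = 1" "coord_v vec_e = 0" "coord_u vec_f = 0" "coord_v vec_f = 1" "coord_u vec_g = -1" "coord_v vec_g = 1"
proof -
  have h: "vec_e = pt 1 0" "vec_f = pt 0 1" "vec_g = pt (-1) 1" by (simp_all add: pt_def vec_g_def)
  show "coord_u vec_e = 1" "coord_v vec_e = 0" "coord_u vec_f = 0" "coord_v vec_f = 1" "coord_u vec_g = -1" "coord_v vec_g = 1"
    unfolding h by simp_all
qed

lemma continuous_on_cu [continuous_intros]: "continuous_on S f \<Longrightarrow> continuous_on S (\<lambda>x. coord_u (f x))"
  unfolding coord_u_def by (intro continuous_intros) auto
lemma continuous_on_cv [continuous_intros]: "continuous_on S f \<Longrightarrow> continuous_on S (\<lambda>x. coord_v (f x))"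
  unfolding coord_v_def by (intro continuous_intros) auto

fun tri_set :: "tri \<Rightarrow> point set" where
  "tri_set (U m n) = {p. of_int m \<le> coord_u p \<and> of_int n \<le> coord_v p \<and> coord_u p + coord_v p \<le> of_int m + of_int n + 1}"
| "tri_set (W m n) = {p. coord_u p \<le> of_int m + 1 \<and> coord_v p \<le> of_int n + 1 \<and> of_int m + of_int n + 1 \<le> coord_u p + coord_v p}"

lemma convex_le_cu_cv: "convex {p. \<alpha> * coord_u p + \<beta> * coord_v p \<le> r}"
proof (rule convexI)
  fix p q and s t :: real
  assume h: "p \<in> {p. \<alpha> * coord_u p + \<beta> * coord_v p \<le> r}" "q \<in> {p. \<alpha> * coord_u p + \<beta> * coord_v p \<le> r}" "0 \<le> s" "0 \<le> t" "s + t = 1"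
  have "s * (\<alpha> * coord_u p + \<beta> * coord_v p) + t * (\<alpha> * coord_u q + \<beta> * coord_v q) \<le> s * r + t * r"
    using h by (intro add_mono mult_left_mono) auto
  also have "s * r + t * r = r" using h(5) by (metis distrib_right mult_1)
  finally show "s *\<^sub>R p + t *\<^sub>R q \<in> {p. \<alpha> * coord_u p + \<beta> * coord_v p \<le> r}"
    by (simp add: algebra_simps)
qed

lemma convex_halfplanes:
  "convex {p. r \<le> coord_u p}" "convex {p. coord_u p \<le> r}" "convex {p. r \<le> coord_v p}" "convex {p. coord_v p \<le> r}"
  "convex {p. r \<le> coord_u p + coord_v p}" "convex {p. coord_u p + coord_v p \<le> r}"
  using convex_le_cu_cv[of "-1" 0 "-r"] convex_le_cu_cv[of 1 0 r] convex_le_cu_cv[of 0 "-1" "-r"]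
    convex_le_cu_cv[of 0 1 r] convex_le_cu_cv[of "-1" "-1" "-r"] convex_le_cu_cv[of 1 1 r]
  by (auto simp: algebra_simps)

lemma convex_tri_set: "convex (tri_set t)"
proof (cases t)
  case (U m n)
  show ?thesis unfolding U tri_set.simps Collect_conj_eq by (intro convex_Int convex_halfplanes)
next
  case (W m n)
  show ?thesis unfolding W tri_set.simps Collect_conj_eq by (intro convex_Int convex_halfplanes)
qed

lemma closed_tri_set: "closed (tri_set t)"
  by (cases t) (auto intro!: closed_Collect_conj closed_Collect_le continuous_intros)

lemma hull_eq_tri_U: "convex hull {pt (of_int m) (of_int n), pt (of_int m + 1) (of_int n), pt (of_int m) (of_int n + 1)} = tri_set (U m n)"
  (is "convex hull ?V = _")
proof
  show "convex hull ?V \<subseteq> tri_set (U m n)"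
    by (intro hull_minimal convex_tri_set) auto
  show "tri_set (U m n) \<subseteq> convex hull ?V"
  proof
    fix p assume p: "p \<in> tri_set (U m n)"
    have e: "p = (of_int m + of_int n + 1 - coord_u p - coord_v p) *\<^sub>R pt (of_int m) (of_int n)
      + (coord_u p - of_int m) *\<^sub>R pt (of_int m + 1) (of_int n) + (coord_v p - of_int n) *\<^sub>R pt (of_int m) (of_int n + 1)"
      by (simp add: point_eq_iff algebra_simps)
    show "p \<in> convex hull ?V" unfolding convex_hull_3 mem_Collect_eq
      by (intro exI conjI, rule e) (use p in auto)
  qed
qed

lemma hull_eq_tri_W: "convex hull {pt (of_int m + 1) (of_int n), pt (of_int m + 1) (of_int n + 1), pt (of_int m) (of_int n + 1)} = tri_set (W m n)"
  (is "convex hull ?V = _")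
proof
  show "convex hull ?V \<subseteq> tri_set (W m n)"
    by (intro hull_minimal convex_tri_set) auto
  show "tri_set (W m n) \<subseteq> convex hull ?V"
  proof
    fix p assume p: "p \<in> tri_set (W m n)"
    have e: "p = (of_int n + 1 - coord_v p) *\<^sub>R pt (of_int m + 1) (of_int n)
      + (coord_u p + coord_v p - of_int m - of_int n - 1) *\<^sub>R pt (of_int m + 1) (of_int n + 1)
      + (of_int m + 1 - coord_u p) *\<^sub>R pt (of_int m) (of_int n + 1)"
      by (simp add: point_eq_iff algebra_simps)
    show "p \<in> convex hull ?V" unfolding convex_hull_3 mem_Collect_eq
      by (intro exI conjI, rule e) (use p in auto)
  qed
qed

lemma tri_lattice_iff: "p \<in> tri_lattice \<longleftrightarrow> (\<exists>m n. p = pt (of_int m) (of_int n))"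
  by (auto simp: tri_lattice_def pt_def)

lemma unit_triangles_eq: "unit_triangles = range tri_set"
proof -
  have 1: "{v, v + vec_e, v + vec_f} = {pt (of_int m) (of_int n), pt (of_int m + 1) (of_int n), pt (of_int m) (of_int n + 1)}"
    if "v = pt (of_int m) (of_int n)" for v m n
    using that by (auto simp: point_eq_iff)
  have 2: "{v, v + vec_f, v + vec_g} = {pt (of_int (m - 1) + 1) (of_int n), pt (of_int (m - 1) + 1) (of_int n + 1), pt (of_int (m - 1)) (of_int n + 1)}"
    if "v = pt (of_int m) (of_int n)" for v m n
    using that by (auto simp: point_eq_iff)
  have h1: "convex hull {v, v + vec_e, v + vec_f} = tri_set (U m n)" if "v = pt (of_int m) (of_int n)" for v m n
    unfolding 1[OF that] by (rule hull_eq_tri_U)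
  have h2: "convex hull {v, v + vec_f, v + vec_g} = tri_set (W (m - 1) n)" if "v = pt (of_int m) (of_int n)" for v m n
    unfolding 2[OF that] by (rule hull_eq_tri_W)
  show ?thesis
  proof (intro equalityI subsetI)
    fix A assume "A \<in> unit_triangles"
    then show "A \<in> range tri_set"
      unfolding unit_triangles_def tri_lattice_iff using h1 h2 by blast
  next
    fix A assume "A \<in> range tri_set"
    then obtain t where A: "A = tri_set t" by blast
    show "A \<in> unit_triangles"
    proof (cases t)
      case (U m n)
      then show ?thesis unfolding A unit_triangles_def tri_lattice_iff using h1[OF refl, of m n] by blast
    next
      case (W m n)
      then show ?thesis unfolding A unit_triangles_def tri_lattice_iff using h2[OF refl, of "m + 1" n]
        unfolding add_diff_cancel_right' by blast
    qed
  qed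
qed

text \<open>A point is generic if it lies on none of the lattice lines; it then lies in exactly one triangle.\<close>
definition generic :: "point \<Rightarrow> bool" where
  "generic p \<longleftrightarrow> coord_u p \<notin> \<int> \<and> coord_v p \<notin> \<int> \<and> coord_u p + coord_v p \<notin> \<int>"

definition tri_at :: "point \<Rightarrow> tri" where
  "tri_at p = (if coord_u p + coord_v p < of_int \<lfloor>coord_u p\<rfloor> + of_int \<lfloor>coord_v p\<rfloor> + 1 then U \<lfloor>coord_u p\<rfloor> \<lfloor>coord_v p\<rfloor> else W \<lfloor>coord_u p\<rfloor> \<lfloor>coord_v p\<rfloor>)"

lemma not_Ints_bounds:
  fixes x :: real
  assumes "x \<notin> \<int>"
  shows "of_int m \<le> x \<longleftrightarrow> m \<le> \<lfloor>x\<rfloor>" "x \<le> of_int m \<longleftrightarrow> \<lfloor>x\<rfloor> < m"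
proof -
  show "of_int m \<le> x \<longleftrightarrow> m \<le> \<lfloor>x\<rfloor>" by (simp add: le_floor_iff)
  have "x \<noteq> of_int m" using assms by auto
  then show "x \<le> of_int m \<longleftrightarrow> \<lfloor>x\<rfloor> < m" by (simp add: floor_less_iff order_le_less)
qed

lemma generic_mem_tri_set:
  assumes "generic p"
  shows "p \<in> tri_set t \<longleftrightarrow> tri_at p = t"
proof -
  define s where "s = \<lfloor>coord_u p + coord_v p\<rfloor>"
  have n: "coord_u p \<notin> \<int>" "coord_v p \<notin> \<int>" "coord_u p + coord_v p \<notin> \<int>" using assms by (auto simp: generic_def)
  have s: "s = \<lfloor>coord_u p\<rfloor> + \<lfloor>coord_v p\<rfloor> \<or> s = \<lfloor>coord_u p\<rfloor> + \<lfloor>coord_v p\<rfloor> + 1"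
    unfolding s_def by linarith
  have t: "coord_u p + coord_v p < of_int \<lfloor>coord_u p\<rfloor> + of_int \<lfloor>coord_v p\<rfloor> + 1 \<longleftrightarrow> s < \<lfloor>coord_u p\<rfloor> + \<lfloor>coord_v p\<rfloor> + 1"
    using floor_less_iff[of "coord_u p + coord_v p" "\<lfloor>coord_u p\<rfloor> + \<lfloor>coord_v p\<rfloor> + 1"]
    by (simp only: of_int_add of_int_1 s_def)
  have t': "tri_at p = (if s < \<lfloor>coord_u p\<rfloor> + \<lfloor>coord_v p\<rfloor> + 1 then U \<lfloor>coord_u p\<rfloor> \<lfloor>coord_v p\<rfloor> else W \<lfloor>coord_u p\<rfloor> \<lfloor>coord_v p\<rfloor>)"
    unfolding tri_at_def t ..
  have e: "of_int m + 1 = (of_int (m + 1) :: real)" "of_int m + of_int k + 1 = (of_int (m + k + 1) :: real)" for m k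
    by simp_all
  show ?thesis
  proof (cases t)
    case (U m k)
    show ?thesis unfolding U t' tri_set.simps e mem_Collect_eq not_Ints_bounds[OF n(1)] not_Ints_bounds[OF n(2)]
      not_Ints_bounds[OF n(3)] s_def[symmetric] using s by auto
  next
    case (W m k)
    show ?thesis unfolding W t' tri_set.simps e mem_Collect_eq not_Ints_bounds[OF n(1)] not_Ints_bounds[OF n(2)]
      not_Ints_bounds[OF n(3)] s_def[symmetric] using s by auto
  qed
qed

lemma uncountable_open_real:
  fixes A :: "real set"
  assumes "open A" "x \<in> A"
  shows "uncountable A"
proof -
  obtain e where "e > 0" "ball x e \<subseteq> A" using assms openE by blast
  then show ?thesis using uncountable_ball[of e x] countable_subset by blast
qed

text \<open>An open set contains a product of two uncountable sets of coordinates, and only countably many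
  values are excluded for each of them.\<close>
lemma generic_dense:
  assumes "open S" "S \<noteq> {}"
  shows "\<exists>p\<in>S. generic p"
proof -
  define S' where "S' = (\<lambda>(u, v). pt u v) -` S"
  have "open S'" unfolding S'_def
    by (intro open_vimage assms(1)) (auto simp: pt_def case_prod_unfold intro!: continuous_intros)
  obtain p0 where "p0 \<in> S" using assms(2) by auto
  then have p0: "(coord_u p0, coord_v p0) \<in> S'" by (simp add: S'_def)
  then obtain A B where AB: "open A" "open B" "(coord_u p0, coord_v p0) \<in> A \<times> B" "A \<times> B \<subseteq> S'"
    using open_prod_elim[OF \<open>open S'\<close> p0] by metis
  have Z: "countable (\<int> :: real set)" by (simp add: Ints_def)
  have "\<not> A \<subseteq> \<int>" using uncountable_open_real[of A "coord_u p0"] AB Z countable_subset by blast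
  then obtain u where u: "u \<in> A" "u \<notin> \<int>" by blast
  have "countable (\<int> \<union> (\<lambda>z. z - u) ` \<int>)" using Z by simp
  then have "\<not> B \<subseteq> \<int> \<union> (\<lambda>z. z - u) ` \<int>"
    using uncountable_open_real[of B "coord_v p0"] AB countable_subset by blast
  then obtain v where v: "v \<in> B" "v \<notin> \<int>" "v \<notin> (\<lambda>z. z - u) ` \<int>" by blast
  have "u + v \<notin> \<int>" using v(3) by (metis add_diff_cancel_left' image_eqI)
  then have "generic (pt u v)" using u v by (simp add: generic_def)
  moreover have "pt u v \<in> S" using u v AB(4) by (auto simp: S'_def)
  ultimately show ?thesis by blast
qed

lemma interior_tri_set_nonempty: "interior (tri_set t) \<noteq> {}"
proof (cases t)
  case (U m n)
  let ?O = "{p. of_int m < coord_u p \<and> of_int n < coord_v p \<and> coord_u p + coord_v p < of_int m + of_int n + 1}"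
  have "open ?O" by (intro open_Collect_conj open_Collect_less continuous_intros)
  moreover have "?O \<subseteq> tri_set t" using U by auto
  moreover have "pt (of_int m + 1/4) (of_int n + 1/4) \<in> ?O" by simp
  ultimately show ?thesis using interior_maximal by blast
next
  case (W m n)
  let ?O = "{p. coord_u p < of_int m + 1 \<and> coord_v p < of_int n + 1 \<and> of_int m + of_int n + 1 < coord_u p + coord_v p}"
  have "open ?O" by (intro open_Collect_conj open_Collect_less continuous_intros)
  moreover have "?O \<subseteq> tri_set t" using W by auto
  moreover have "pt (of_int m + 3/4) (of_int n + 3/4) \<in> ?O" by simp
  ultimately show ?thesis using interior_maximal by blast
qed

definition region :: "tri set \<Rightarrow> point set" where
  "region X = \<Union> (tri_set ` X)"

lemma generic_mem_region: "generic p \<Longrightarrow> p \<in> region X \<longleftrightarrow> tri_at p \<in> X"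
  by (auto simp: region_def generic_mem_tri_set)

lemma generic_in_tri: obtains p where "generic p" "tri_at p = t" "p \<in> interior (tri_set t)"
proof -
  obtain p where "p \<in> interior (tri_set t)" "generic p"
    using generic_dense[OF open_interior interior_tri_set_nonempty] by blast
  then show thesis using that generic_mem_tri_set interior_subset by blast
qed

lemma region_subset_iff: "region X \<subseteq> region Y \<longleftrightarrow> X \<subseteq> Y"
proof
  assume *: "region X \<subseteq> region Y"
  show "X \<subseteq> Y"
  proof
    fix t assume "t \<in> X"
    obtain p where p: "generic p" "tri_at p = t" by (rule generic_in_tri)
    then show "t \<in> Y" using * \<open>t \<in> X\<close> generic_mem_region by blast
  qed
qed (auto simp: region_def)

lemma inj_region: "inj region"
  by (rule injI) (metis region_subset_iff subset_antisym subset_refl)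

text \<open>Interiors that meet have a generic point in common, whose triangle belongs to both sets; conversely,
  triangles have interior points.\<close>
lemma interior_regions_disjoint_iff:
  "interior (region A) \<inter> interior (region B) = {} \<longleftrightarrow> A \<inter> B = {}"
proof
  assume *: "interior (region A) \<inter> interior (region B) = {}"
  have sub: "interior (tri_set t) \<subseteq> interior (region C)" if "t \<in> C" for t C
    using that by (intro interior_mono) (auto simp: region_def)
  show "A \<inter> B = {}"
  proof (rule ccontr)
    assume "A \<inter> B \<noteq> {}"
    then obtain t where "t \<in> A" "t \<in> B" by blast
    then have "interior (tri_set t) \<subseteq> interior (region A) \<inter> interior (region B)"
      by (intro Int_greatest sub)
    then show False using * interior_tri_set_nonempty[of t] by simp
  qed
next
  assume *: "A \<inter> B = {}"
  show "interior (region A) \<inter> interior (region B) = {}"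
  proof (rule ccontr)
    assume ne: "interior (region A) \<inter> interior (region B) \<noteq> {}"
    then obtain p where "p \<in> interior (region A) \<inter> interior (region B)" "generic p"
      using generic_dense[OF open_Int[OF open_interior open_interior] ne] by blast
    then have "p \<in> region A" "p \<in> region B" "generic p" using interior_subset by blast+
    then have "tri_at p \<in> A \<inter> B" by (simp add: generic_mem_region)
    then show False using * by simp
  qed
qed

lemma closed_region: "finite X \<Longrightarrow> closed (region X)"
  unfolding region_def by (intro closed_Union) (auto simp: closed_tri_set)

lemma generic_dense_in_convex:
  assumes "convex K" "interior K \<noteq> {}"
  shows "K \<subseteq> closure {p \<in> K. generic p}"
proof
  fix x assume "x \<in> K"
  then have x: "x \<in> closure (interior K)"
    using closure_subset convex_closure_interior[OF assms] by blast
  show "x \<in> closure {p \<in> K. generic p}"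
  proof (subst closure_iff_nhds_not_empty, intro allI impI)
    fix A V assume AV: "V \<subseteq> A" "open V" "x \<in> V"
    then have ne: "V \<inter> interior K \<noteq> {}"
      using x by (metis closure_iff_nhds_not_empty Int_commute order_refl)
    then obtain p where "p \<in> V \<inter> interior K" "generic p"
      using generic_dense[OF open_Int[OF AV(2) open_interior] ne] by blast
    then show "{p \<in> K. generic p} \<inter> A \<noteq> {}"
      using AV interior_subset by blast
  qed
qed

text \<open>A closed set in which the generic points are dense is determined by its generic points.\<close>
lemma region_eqI:
  assumes "finite X" "closed K" "K \<subseteq> closure {p \<in> K. generic p}"
    and "\<And>p. generic p \<Longrightarrow> p \<in> K \<longleftrightarrow> tri_at p \<in> X"
  shows "K = region X"
proof
  have "{p \<in> K. generic p} \<subseteq> region X" using assms(4) generic_mem_region by blast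
  then show "K \<subseteq> region X"
    using assms(3) closure_minimal[OF _ closed_region[OF assms(1)]] by blast
  show "region X \<subseteq> K"
    unfolding region_def
  proof (intro UN_least)
    fix t assume "t \<in> X"
    then have "{p \<in> tri_set t. generic p} \<subseteq> K" by (auto simp: assms(4) generic_mem_tri_set)
    then show "tri_set t \<subseteq> K"
      by (rule order_trans[OF generic_dense_in_convex[OF convex_tri_set interior_tri_set_nonempty]
            closure_minimal[OF _ assms(2)]])
  qed
qed

text \<open>A triangle outside \<open>Y\<close> is the closure of its generic points, and these avoid \<open>region Y\<close>.\<close>
lemma closure_region_diff:
  assumes "finite X"
  shows "closure (region X - region Y) = region (X - Y)"
proof
  show "closure (region X - region Y) \<subseteq> region (X - Y)"
    by (rule closure_minimal, force simp: region_def, rule closed_region) (use assms in simp)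
  have "tri_set t \<subseteq> closure (region X - region Y)" if "t \<in> X - Y" for t
  proof -
    have "{p \<in> tri_set t. generic p} \<subseteq> region X - region Y"
      using that by (auto simp: generic_mem_region generic_mem_tri_set)
    then show ?thesis
      by (rule order_trans[OF generic_dense_in_convex[OF convex_tri_set interior_tri_set_nonempty] closure_mono])
  qed
  then show "region (X - Y) \<subseteq> closure (region X - region Y)"
    by (auto simp: region_def)
qed

section \<open>Tilings as dimer covers\<close>

text \<open>The pairs of triangles that have an edge in common.\<close>
definition dimers :: "tri set set" where
  "dimers = (\<Union>m n. {{U m n, W m n}, {U m n, W m (n - 1)}, {U m n, W (m - 1) n}})"

lemma lattice_in_tri_set:
  "pt (of_int i) (of_int j) \<in> tri_set (U m n) \<longleftrightarrow> m \<le> i \<and> n \<le> j \<and> i + j \<le> m + n + 1"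
  "pt (of_int i) (of_int j) \<in> tri_set (W m n) \<longleftrightarrow> i \<le> m + 1 \<and> j \<le> n + 1 \<and> m + n + 1 \<le> i + j"
  by (simp; linarith)+

lemma closed_segment_pt:
  "p \<in> closed_segment (pt x y) (pt x' y') \<longleftrightarrow> (\<exists>t\<ge>0. t \<le> 1 \<and> coord_u p = x + t * (x' - x) \<and> coord_v p = y + t * (y' - y))"
  by (auto simp: in_segment point_eq_iff algebra_simps)

text \<open>The two end points of the common segment are lattice points in both triangles, hence common
  vertices, and this leaves only neighbouring triangles. Two equal triangles are excluded because their
  intersection contains generic points, which lie on no lattice segment.\<close>
lemma share_edge_dimers:
  assumes "share_edge (tri_set s) (tri_set t)"
  shows "{s, t} \<in> dimers"
proof -
  obtain i j k l where uv: "(i, j) \<noteq> (k, l)"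
    and seg: "tri_set s \<inter> tri_set t = closed_segment (pt (of_int i) (of_int j)) (pt (of_int k) (of_int l))"
  proof -
    obtain u v where uv: "u \<in> tri_lattice" "v \<in> tri_lattice" "dist u v = 1" "tri_set s \<inter> tri_set t = closed_segment u v"
      using assms unfolding share_edge_def by blast
    obtain i j k l where ij: "u = pt (of_int i) (of_int j)" "v = pt (of_int k) (of_int l)"
      using uv(1,2) unfolding tri_lattice_iff by blast
    have "u \<noteq> v" using uv(3) by auto
    then have "(i, j) \<noteq> (k, l)" unfolding ij by auto
    then show ?thesis using that uv(4) unfolding ij by blast
  qed
  let ?p = "pt (of_int i) (of_int j)" and ?q = "pt (of_int k) (of_int l)"
  have v: "?p \<in> tri_set s" "?q \<in> tri_set s" "?p \<in> tri_set t" "?q \<in> tri_set t"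
    using seg ends_in_segment[of ?p ?q] by blast+
  have "s \<noteq> t"
  proof
    assume "s = t"
    obtain p where p: "generic p" "p \<in> tri_set s"
      by (metis generic_in_tri generic_mem_tri_set)
    then have "p \<in> closed_segment ?p ?q" using seg \<open>s = t\<close> by blast
    then obtain r where r: "coord_u p = of_int i + r * (of_int k - of_int i)" "coord_v p = of_int j + r * (of_int l - of_int j)"
      unfolding closed_segment_pt by blast
    have "i = k \<or> j = l \<or> i + j = k + l"
      using v(1,2) by (cases s) (simp_all only: lattice_in_tri_set, linarith+)
    then have "coord_u p = of_int i \<or> coord_v p = of_int j \<or> coord_u p + coord_v p = of_int (i + j)"
    proof (elim disjE)
      assume "i + j = k + l"
      then have l: "l = i + j - k" by simp
      have "coord_u p + coord_v p = of_int (i + j)" unfolding r l by (simp add: algebra_simps)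
      then show ?thesis by simp
    qed (simp_all add: r algebra_simps)
    then show False using p(1) unfolding generic_def by auto
  qed
  show ?thesis
  proof (cases s; cases t)
    fix m n m' n' assume st: "s = U m n" "t = U m' n'"
    have "m = m' \<and> n = n'"
      using v uv unfolding st lattice_in_tri_set by (smt (verit) prod.inject)
    then have False using \<open>s \<noteq> t\<close> st by simp
    then show ?thesis ..
  next
    fix m n m' n' assume st: "s = W m n" "t = W m' n'"
    have "m = m' \<and> n = n'"
      using v uv unfolding st lattice_in_tri_set by (smt (verit) prod.inject)
    then have False using \<open>s \<noteq> t\<close> st by simp
    then show ?thesis ..
  next
    fix m n m' n' assume st: "s = U m n" "t = W m' n'"
    have "m' = m \<and> n' = n \<or> m' = m \<and> n' = n - 1 \<or> m' = m - 1 \<and> n' = n"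
      using v uv unfolding st lattice_in_tri_set by (smt (verit) prod.inject)
    then show ?thesis unfolding dimers_def st by auto
  next
    fix m n m' n' assume st: "s = W m n" "t = U m' n'"
    have "m = m' \<and> n = n' \<or> m = m' \<and> n = n' - 1 \<or> m = m' - 1 \<and> n = n'"
      using v uv unfolding st lattice_in_tri_set by (smt (verit) prod.inject)
    then show ?thesis unfolding dimers_def st by auto
  qed
qed

lemma dist_pt_unit:
  "dist (pt x y) (pt (x + 1) y) = 1" "dist (pt x y) (pt x (y + 1)) = 1" "dist (pt (x + 1) y) (pt x (y + 1)) = 1"
  by (simp_all add: pt_alt dist_Pair_Pair dist_real_def power2_eq_square field_simps)

lemma share_edge_U_W:
  "share_edge (tri_set (U m n)) (tri_set (W m n))"
  "share_edge (tri_set (U m n)) (tri_set (W m (n - 1)))"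
  "share_edge (tri_set (U m n)) (tri_set (W (m - 1) n))"
proof -
  have I: "share_edge S T" if "S \<inter> T = closed_segment (pt (of_int i) (of_int j)) (pt (of_int k) (of_int l))"
      "dist (pt (of_int i) (of_int j)) (pt (of_int k) (of_int l)) = 1" for S T i j k l
    unfolding share_edge_def using that
    by (intro bexI[of _ "pt (of_int i) (of_int j)"] bexI[of _ "pt (of_int k) (of_int l)"])
      (auto simp: tri_lattice_iff)
  have seg: "p \<in> closed_segment (pt (x + 1) y) (pt x (y + 1)) \<longleftrightarrow> coord_u p + coord_v p = x + y + 1 \<and> y \<le> coord_v p \<and> coord_v p \<le> y + 1"
    "p \<in> closed_segment (pt x y) (pt (x + 1) y) \<longleftrightarrow> coord_v p = y \<and> x \<le> coord_u p \<and> coord_u p \<le> x + 1"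
    "p \<in> closed_segment (pt x y) (pt x (y + 1)) \<longleftrightarrow> coord_u p = x \<and> y \<le> coord_v p \<and> coord_v p \<le> y + 1" for p x y
    unfolding closed_segment_pt
    by (auto intro: exI[of _ "coord_v p - y"] exI[of _ "coord_u p - x"])
  have 1: "tri_set (U m n) \<inter> tri_set (W m n) = closed_segment (pt (of_int (m + 1)) (of_int n)) (pt (of_int m) (of_int (n + 1)))"
    by (rule Set.set_eqI) (simp add: seg, linarith)
  have 2: "tri_set (U m n) \<inter> tri_set (W m (n - 1)) = closed_segment (pt (of_int m) (of_int n)) (pt (of_int (m + 1)) (of_int n))"
    by (rule Set.set_eqI) (simp add: seg, linarith)
  have 3: "tri_set (U m n) \<inter> tri_set (W (m - 1) n) = closed_segment (pt (of_int m) (of_int n)) (pt (of_int m) (of_int (n + 1)))"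
    by (rule Set.set_eqI) (simp add: seg, linarith)
  show "share_edge (tri_set (U m n)) (tri_set (W m n))"
    by (rule I[OF 1]) (simp add: dist_pt_unit)
  show "share_edge (tri_set (U m n)) (tri_set (W m (n - 1)))"
    by (rule I[OF 2]) (simp add: dist_pt_unit)
  show "share_edge (tri_set (U m n)) (tri_set (W (m - 1) n))"
    by (rule I[OF 3]) (simp add: dist_pt_unit)
qed

lemma lozenges_eq: "lozenges = region ` dimers"
proof -
  have r: "tri_set s \<union> tri_set t = region {s, t}" for s t by (auto simp: region_def)
  show ?thesis
  proof (intro equalityI subsetI)
    fix A assume "A \<in> lozenges"
    then obtain s t where "A = tri_set s \<union> tri_set t" "share_edge (tri_set s) (tri_set t)"
      unfolding lozenges_def unit_triangles_eq by auto
    then show "A \<in> region ` dimers" using share_edge_dimers r by blast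
  next
    fix A assume "A \<in> region ` dimers"
    then obtain l where l: "l \<in> dimers" "A = region l" by blast
    then obtain s t where "l = {s, t}" "share_edge (tri_set s) (tri_set t)"
      unfolding dimers_def using share_edge_U_W by blast
    with l have "A = tri_set s \<union> tri_set t" "share_edge (tri_set s) (tri_set t)" by (simp_all add: r)
    then show "A \<in> lozenges" unfolding lozenges_def unit_triangles_eq by auto
  qed
qed

definition dimer_covers :: "tri set \<Rightarrow> tri set set set" where
  "dimer_covers X = {M. M \<subseteq> dimers \<and> pairwise disjnt M \<and> \<Union> M = X}"

lemma lozenge_tiling_region_iff:
  "lozenge_tiling (region X) \<T> \<longleftrightarrow> \<T> \<in> (`) region ` dimer_covers X"
proof -
  have *: "lozenge_tiling (region X) (region ` M) \<longleftrightarrow> M \<in> dimer_covers X" if M: "M \<subseteq> dimers" for M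
  proof -
    have u: "\<Union> (region ` M) = region (\<Union> M)" by (auto simp: region_def)
    have "pairwise (\<lambda>A B. interior A \<inter> interior B = {}) (region ` M) \<longleftrightarrow> pairwise disjnt M"
      unfolding pairwise_def disjnt_def using inj_region
      by (auto simp: inj_eq interior_regions_disjoint_iff)
    then show ?thesis
      unfolding lozenge_tiling_def dimer_covers_def u lozenges_eq
      using M inj_region by (auto simp: inj_eq)
  qed
  show ?thesis
  proof
    assume t: "lozenge_tiling (region X) \<T>"
    then obtain M where "M \<subseteq> dimers" "\<T> = region ` M"
      unfolding lozenge_tiling_def lozenges_eq by (auto simp: subset_image_iff)
    then show "\<T> \<in> (`) region ` dimer_covers X" using * t by blast
  next
    assume "\<T> \<in> (`) region ` dimer_covers X"
    then show "lozenge_tiling (region X) \<T>" using * by (auto simp: dimer_covers_def)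
  qed
qed

text \<open>The map \<open>region\<close> is injective and translates the three defining conditions of a tiling one by one.\<close>
theorem num_tilings_region: "num_tilings (region X) = card (dimer_covers X)"
proof -
  have "{\<T>. lozenge_tiling (region X) \<T>} = (`) region ` dimer_covers X"
    by (simp add: lozenge_tiling_region_iff)
  moreover have "inj_on ((`) region) (dimer_covers X)"
    by (rule inj_onI) (simp only: inj_image_eq_iff[OF inj_region])
  ultimately show ?thesis by (simp add: num_tilings_def card_image)
qed

section \<open>The region as a set of triangles\<close>

lemma convex_hull_parallelogram:
  fixes V s t :: "'a::real_vector"
  shows "convex hull {V + (x - 1) *\<^sub>R s + (y - 1) *\<^sub>R t, V + x *\<^sub>R s + (y - 1) *\<^sub>R t,
      V + x *\<^sub>R s + y *\<^sub>R t, V + (x - 1) *\<^sub>R s + y *\<^sub>R t}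
    = {V + \<alpha> *\<^sub>R s + \<beta> *\<^sub>R t | \<alpha> \<beta>. x - 1 \<le> \<alpha> \<and> \<alpha> \<le> x \<and> y - 1 \<le> \<beta> \<and> \<beta> \<le> y}"
    (is "convex hull ?V = ?P")
proof
  show "convex hull ?V \<subseteq> ?P"
  proof (rule hull_minimal)
    show "convex ?P"
    proof (rule convexI, clarify)
      fix l m :: real and \<alpha> \<beta> \<alpha>' \<beta>' :: real
      assume lm: "0 \<le> l" "0 \<le> m" "l + m = 1" and b: "x - 1 \<le> \<alpha>" "\<alpha> \<le> x" "y - 1 \<le> \<beta>" "\<beta> \<le> y"
        "x - 1 \<le> \<alpha>'" "\<alpha>' \<le> x" "y - 1 \<le> \<beta>'" "\<beta>' \<le> y"
      have m: "m = 1 - l" using lm by simp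
      have bound: "lo \<le> l * r + m * r' \<and> l * r + m * r' \<le> hi"
        if "lo \<le> r" "r \<le> hi" "lo \<le> r'" "r' \<le> hi" for lo hi r r' :: real
      proof -
        have "l * lo + m * lo \<le> l * r + m * r'" "l * r + m * r' \<le> l * hi + m * hi"
          using lm that by (auto intro!: add_mono mult_left_mono)
        moreover have "l * lo + m * lo = lo" "l * hi + m * hi = hi" by (simp_all add: m algebra_simps)
        ultimately show ?thesis by simp
      qed
      have "l *\<^sub>R (V + \<alpha> *\<^sub>R s + \<beta> *\<^sub>R t) + m *\<^sub>R (V + \<alpha>' *\<^sub>R s + \<beta>' *\<^sub>R t)
        = V + (l * \<alpha> + m * \<alpha>') *\<^sub>R s + (l * \<beta> + m * \<beta>') *\<^sub>R t"
        unfolding m by (simp add: algebra_simps)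
      then show "\<exists>\<alpha>'' \<beta>''. l *\<^sub>R (V + \<alpha> *\<^sub>R s + \<beta> *\<^sub>R t) + m *\<^sub>R (V + \<alpha>' *\<^sub>R s + \<beta>' *\<^sub>R t) = V + \<alpha>'' *\<^sub>R s + \<beta>'' *\<^sub>R t
          \<and> x - 1 \<le> \<alpha>'' \<and> \<alpha>'' \<le> x \<and> y - 1 \<le> \<beta>'' \<and> \<beta>'' \<le> y"
        using bound[of "x - 1" \<alpha> x \<alpha>'] bound[of "y - 1" \<beta> y \<beta>'] b by blast
    qed
    show "?V \<subseteq> ?P" by force
  qed
  show "?P \<subseteq> convex hull ?V"
  proof clarify
    fix \<alpha> \<beta> assume b: "x - 1 \<le> \<alpha>" "\<alpha> \<le> x" "y - 1 \<le> \<beta>" "\<beta> \<le> y"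
    define l m where "l = \<alpha> - (x - 1)" and "m = \<beta> - (y - 1)"
    have lm: "0 \<le> l" "l \<le> 1" "0 \<le> m" "m \<le> 1" using b by (auto simp: l_def m_def)
    define q where "q z = (1 - l) *\<^sub>R (V + (x - 1) *\<^sub>R s + z *\<^sub>R t) + l *\<^sub>R (V + x *\<^sub>R s + z *\<^sub>R t)" for z
    have "q (y - 1) \<in> convex hull ?V" "q y \<in> convex hull ?V"
      unfolding q_def by (intro convexD[OF convex_convex_hull] hull_inc; use lm in simp)+
    then have "(1 - m) *\<^sub>R q (y - 1) + m *\<^sub>R q y \<in> convex hull ?V"
      using lm by (intro convexD[OF convex_convex_hull]) auto
    also have "(1 - m) *\<^sub>R q (y - 1) + m *\<^sub>R q y = V + \<alpha> *\<^sub>R s + \<beta> *\<^sub>R t"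
      unfolding q_def l_def m_def by (simp add: algebra_simps)
    finally show "V + \<alpha> *\<^sub>R s + \<beta> *\<^sub>R t \<in> convex hull ?V" .
  qed
qed

lemma staircase_cell_iff:
  "p \<in> staircase_cell V s t i j \<longleftrightarrow>
    (\<exists>\<alpha> \<beta>. p = V + \<alpha> *\<^sub>R s + \<beta> *\<^sub>R t \<and> real i - 1 \<le> \<alpha> \<and> \<alpha> \<le> real i \<and> real j - 1 \<le> \<beta> \<and> \<beta> \<le> real j)"
  unfolding staircase_cell_def convex_hull_parallelogram by blast

lemma staircase_cell_NW:
  "staircase_cell (pt (of_int x) (of_int y)) (- vec_f) vec_e i j
    = region {U (x + int j - 1) (y - int i), W (x + int j - 1) (y - int i)}"
proof (rule Set.set_eqI)
  fix p
  have "p \<in> staircase_cell (pt (of_int x) (of_int y)) (- vec_f) vec_e i j \<longleftrightarrow>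
    of_int y - coord_v p \<in> {real i - 1..real i} \<and> coord_u p - of_int x \<in> {real j - 1..real j}"
    unfolding staircase_cell_iff
    by (auto simp: point_eq_iff) (rule exI[of _ "of_int y - coord_v p"], rule exI[of _ "coord_u p - of_int x"], simp)
  then show "p \<in> staircase_cell (pt (of_int x) (of_int y)) (- vec_f) vec_e i j
    \<longleftrightarrow> p \<in> region {U (x + int j - 1) (y - int i), W (x + int j - 1) (y - int i)}"
    by (simp add: region_def) linarith
qed

lemma staircase_cell_NE:
  "staircase_cell (pt (of_int x) (of_int y)) (- vec_e) (- vec_g) i j
    = region {U (x + int j - int i) (y - int j), W (x + int j - int i - 1) (y - int j)}"
proof (rule Set.set_eqI)
  fix p
  have "p \<in> staircase_cell (pt (of_int x) (of_int y)) (- vec_e) (- vec_g) i j \<longleftrightarrow>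
    of_int x + of_int y - coord_u p - coord_v p \<in> {real i - 1..real i} \<and> of_int y - coord_v p \<in> {real j - 1..real j}"
    unfolding staircase_cell_iff
    by (auto simp: point_eq_iff)
      (rule exI[of _ "of_int x + of_int y - coord_u p - coord_v p"], rule exI[of _ "of_int y - coord_v p"], simp)
  then show "p \<in> staircase_cell (pt (of_int x) (of_int y)) (- vec_e) (- vec_g) i j
    \<longleftrightarrow> p \<in> region {U (x + int j - int i) (y - int j), W (x + int j - int i - 1) (y - int j)}"
    by (simp add: region_def) linarith
qed

text \<open>For the harder inclusion, a point is placed on the horizontal segment through it that joins the left and
  the right boundary of the hexagon; the end points \<open>pt l y\<close>, \<open>pt r y\<close> lie on segments between vertices.\<close>
lemma hexagon_iff:
  "p \<in> hexagon a b c \<longleftrightarrow> - real c \<le> coord_u p \<and> coord_u p \<le> real b \<and> 0 \<le> coord_v p \<and> coord_v p \<le> real (a + c)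
     \<and> 0 \<le> coord_u p + coord_v p \<and> coord_u p + coord_v p \<le> real (a + b)"
proof -
  define K where "K = {p. - real c \<le> coord_u p \<and> coord_u p \<le> real b \<and> 0 \<le> coord_v p \<and> coord_v p \<le> real (a + c)
     \<and> 0 \<le> coord_u p + coord_v p \<and> coord_u p + coord_v p \<le> real (a + b)}"
  define v where "v = {pt 0 0, pt (real b) 0, pt (real b) (real a), pt (real b - real c) (real a + real c), pt (- real c) (real a + real c), pt (- real c) (real c)}"
  have hex: "hexagon a b c = convex hull v"
  proof -
    have "0 = pt 0 0" "real b *\<^sub>R vec_e = pt (real b) 0" "real b *\<^sub>R vec_e + real a *\<^sub>R vec_f = pt (real b) (real a)"
      "real b *\<^sub>R vec_e + real a *\<^sub>R vec_f + real c *\<^sub>R vec_g = pt (real b - real c) (real a + real c)"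
      "real a *\<^sub>R vec_f + real c *\<^sub>R vec_g = pt (- real c) (real a + real c)" "real c *\<^sub>R vec_g = pt (- real c) (real c)"
      by (simp_all add: point_eq_iff)
    then show ?thesis unfolding hexagon_def v_def by (simp only:)
  qed
  have "convex hull v \<subseteq> K"
  proof (rule hull_minimal)
    show "convex K" unfolding K_def Collect_conj_eq by (intro convex_Int convex_halfplanes)
    show "v \<subseteq> K" unfolding v_def K_def by auto
  qed
  moreover have "K \<subseteq> convex hull v"
  proof
    fix p assume p: "p \<in> K"
    have seg: "pt x y \<in> convex hull v" if "pt x0 y0 \<in> convex hull v" "pt x1 y1 \<in> convex hull v"
      "0 \<le> s" "s \<le> 1" "x = x0 + s * (x1 - x0)" "y = y0 + s * (y1 - y0)" for x y x0 y0 x1 y1 s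
    proof -
      have "pt x y \<in> closed_segment (pt x0 y0) (pt x1 y1)"
        using that(3-6) unfolding closed_segment_pt by auto
      then show ?thesis
        using closed_segment_subset[OF that(1,2) convex_convex_hull] by blast
    qed
    have "v \<subseteq> convex hull v" by (rule hull_subset)
    then have vert: "pt 0 0 \<in> convex hull v" "pt (real b) 0 \<in> convex hull v" "pt (real b) (real a) \<in> convex hull v"
      "pt (real b - real c) (real a + real c) \<in> convex hull v" "pt (- real c) (real a + real c) \<in> convex hull v" "pt (- real c) (real c) \<in> convex hull v"
      by (simp_all add: v_def)
    define y where "y = coord_v p"
    define l where "l = max (- real c) (- y)"
    define r where "r = min (real b) (real (a + b) - y)"
    have y: "0 \<le> y" "y \<le> real (a + c)" and lr: "l \<le> coord_u p" "coord_u p \<le> r"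
      using p by (auto simp: K_def y_def l_def r_def)
    have L: "pt l y \<in> convex hull v"
    proof (cases "y \<le> real c")
      case True
      show ?thesis
        by (rule seg[of 0 0 "- real c" "real c" "y / real c"])
          (use True y in \<open>auto simp: vert l_def max_def divide_simps\<close>)
    next
      case False
      show ?thesis
        by (rule seg[of "- real c" "real c" "- real c" "real a + real c" "(y - real c) / real a"])
          (use False y in \<open>auto simp: vert l_def max_def divide_simps\<close>)
    qed
    have R: "pt r y \<in> convex hull v"
    proof (cases "y \<le> real a")
      case True
      show ?thesis
        by (rule seg[of "real b" 0 "real b" "real a" "y / real a"])
          (use True y in \<open>auto simp: vert r_def min_def divide_simps\<close>)
    next
      case False
      show ?thesis
        by (rule seg[of "real b" "real a" "real b - real c" "real a + real c" "(y - real a) / real c"])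
          (use False y in \<open>auto simp: vert r_def min_def divide_simps\<close>)
    qed
    show "p \<in> convex hull v"
    proof (cases "l = r")
      case True
      then have "p = pt l y" using lr by (simp add: point_eq_iff y_def)
      then show ?thesis using L by simp
    next
      case False
      have "pt (coord_u p) y \<in> convex hull v"
        by (rule seg[OF L R, of "(coord_u p - l) / (r - l)"]) (use False lr in \<open>auto simp: divide_simps\<close>)
      then show ?thesis by (simp add: y_def)
    qed
  qed
  ultimately show ?thesis unfolding hex by (auto simp: K_def)
qed

fun in_hexagon :: "nat \<Rightarrow> nat \<Rightarrow> nat \<Rightarrow> tri \<Rightarrow> bool" where
  "in_hexagon a b c (U m n) \<longleftrightarrow> - int c \<le> m \<and> m < int b \<and> 0 \<le> n \<and> n < int (a + c) \<and> 0 \<le> m + n \<and> m + n < int (a + b)"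
| "in_hexagon a b c (W m n) \<longleftrightarrow> - int c \<le> m \<and> m < int b \<and> 0 \<le> n \<and> n < int (a + c) \<and> 0 \<le> m + n + 1 \<and> m + n + 1 < int (a + b)"

lemma finite_in_hexagon: "finite {t. in_hexagon a b c t}"
proof (rule finite_subset)
  show "{t. in_hexagon a b c t} \<subseteq> (\<lambda>(m, n). U m n) ` ({- int c..int b} \<times> {0..int (a + c)})
     \<union> (\<lambda>(m, n). W m n) ` ({- int c..int b} \<times> {0..int (a + c)})"
  proof
    fix t assume "t \<in> {t. in_hexagon a b c t}"
    then show "t \<in> (\<lambda>(m, n). U m n) ` ({- int c..int b} \<times> {0..int (a + c)})
     \<union> (\<lambda>(m, n). W m n) ` ({- int c..int b} \<times> {0..int (a + c)})"
      by (cases t) auto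
  qed
qed auto

lemma hexagon_region:
  assumes "b \<ge> 1" "a \<ge> 1"
  shows "hexagon a b c = region {t. in_hexagon a b c t}"
proof (rule region_eqI)
  show "finite {t. in_hexagon a b c t}" by (rule finite_in_hexagon)
  show "closed (hexagon a b c)"
    unfolding hexagon_def by (intro compact_imp_closed finite_imp_compact_convex_hull) simp
  have conv: "convex (hexagon a b c)" unfolding hexagon_def by simp
  have "tri_set (U 0 0) \<subseteq> hexagon a b c"
    using assms by (auto simp: hexagon_iff)
  then have "interior (hexagon a b c) \<noteq> {}"
    using interior_mono interior_tri_set_nonempty[of "U 0 0"] by blast
  then show "hexagon a b c \<subseteq> closure {p \<in> hexagon a b c. generic p}"
    by (rule generic_dense_in_convex[OF conv])
  fix p assume p: "generic p"
  then have n: "coord_u p \<notin> \<int>" "coord_v p \<notin> \<int>" "coord_u p + coord_v p \<notin> \<int>" by (auto simp: generic_def)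
  have e: "real k = of_int (int k)" "- of_int z = (of_int (- z) :: real)" "(0 :: real) = of_int 0" for k z by simp_all
  have "p \<in> tri_set (tri_at p)" using p generic_mem_tri_set by blast
  moreover have "p \<in> hexagon a b c \<longleftrightarrow> - int c \<le> \<lfloor>coord_u p\<rfloor> \<and> \<lfloor>coord_u p\<rfloor> < int b \<and> 0 \<le> \<lfloor>coord_v p\<rfloor> \<and> \<lfloor>coord_v p\<rfloor> < int (a + c)
      \<and> 0 \<le> \<lfloor>coord_u p + coord_v p\<rfloor> \<and> \<lfloor>coord_u p + coord_v p\<rfloor> < int (a + b)"
    unfolding hexagon_iff e not_Ints_bounds[OF n(1)] not_Ints_bounds[OF n(2)] not_Ints_bounds[OF n(3)] ..
  moreover have "\<lfloor>coord_u p + coord_v p\<rfloor> = \<lfloor>coord_u p\<rfloor> + \<lfloor>coord_v p\<rfloor>" if "coord_u p + coord_v p < of_int \<lfloor>coord_u p\<rfloor> + of_int \<lfloor>coord_v p\<rfloor> + 1"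
    using that by linarith
  moreover have "\<lfloor>coord_u p + coord_v p\<rfloor> = \<lfloor>coord_u p\<rfloor> + \<lfloor>coord_v p\<rfloor> + 1" if "\<not> coord_u p + coord_v p < of_int \<lfloor>coord_u p\<rfloor> + of_int \<lfloor>coord_v p\<rfloor> + 1"
    using that by linarith
  ultimately show "p \<in> hexagon a b c \<longleftrightarrow> tri_at p \<in> {t. in_hexagon a b c t}"
    unfolding tri_at_def mem_Collect_eq by (cases "coord_u p + coord_v p < of_int \<lfloor>coord_u p\<rfloor> + of_int \<lfloor>coord_v p\<rfloor> + 1") auto
qed

text \<open>The last two conjuncts are the zigzag boundaries left by the staircases: from one strip to the
  next, the left one rises by one, and the right one falls by one in every second strip.\<close>
fun in_Ha :: "nat \<Rightarrow> nat \<Rightarrow> nat \<Rightarrow> tri \<Rightarrow> bool" where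
  "in_Ha a b c (U m n) \<longleftrightarrow> - int c \<le> m \<and> m < int b \<and> 0 \<le> n \<and> n < int (a + c) \<and> 0 \<le> m + n
      \<and> n \<le> m + 2 * int c \<and> 2 * n + m < 2 * int a + int b"
| "in_Ha a b c (W m n) \<longleftrightarrow> - int c \<le> m \<and> m < int b \<and> 0 \<le> n \<and> n < int (a + c) \<and> 0 \<le> m + n + 1
      \<and> n \<le> m + 2 * int c \<and> 2 * n + m + 1 < 2 * int a + int b"

lemma region_Union: "region (\<Union> \<A>) = \<Union> (region ` \<A>)"
  by (auto simp: region_def)

text \<open>By \<open>b \<ge> a + c - 1\<close> the staircases have sizes \<open>a - 1\<close> and \<open>c - 1\<close>. The numbers \<open>i\<close>, \<open>j\<close> of the cell that
  contains a triangle are linear functions of \<open>m\<close> and \<open>n\<close>, so the condition \<open>i + j \<le> a\<close> or \<open>i + j \<le> c\<close> becomes a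
  linear inequality.\<close>
theorem hexagon_a_region:
  assumes "a \<ge> 1" "b \<ge> 1" "c \<ge> 1" "b \<ge> a + c - 1"
  shows "hexagon_a a b c = region {t. in_Ha a b c t}"
proof -
  define NW where "NW = \<Union> {{U (- int c + int j - 1) (int (a + c) - int i), W (- int c + int j - 1) (int (a + c) - int i)}
      | i j. 1 \<le> i \<and> 1 \<le> j \<and> i + j \<le> min a b}"
  define NE where "NE = \<Union> {{U (int b - int c + int j - int i) (int (a + c) - int j), W (int b - int c + int j - int i - 1) (int (a + c) - int j)}
      | i j. 1 \<le> i \<and> 1 \<le> j \<and> i + j \<le> min b c}"
  have v1: "real a *\<^sub>R vec_f + real c *\<^sub>R vec_g = pt (of_int (- int c)) (of_int (int (a + c)))"
    and v2: "real b *\<^sub>R vec_e + real a *\<^sub>R vec_f + real c *\<^sub>R vec_g = pt (of_int (int b - int c)) (of_int (int (a + c)))"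
    by (simp_all add: point_eq_iff)
  have s1: "maximal_staircase (real a *\<^sub>R vec_f + real c *\<^sub>R vec_g) a (- vec_f) b vec_e = region NW"
    unfolding v1 maximal_staircase_def staircase_cell_NW NW_def region_Union
    by (rule arg_cong[of _ _ Union]) blast
  have s2: "maximal_staircase (real b *\<^sub>R vec_e + real a *\<^sub>R vec_f + real c *\<^sub>R vec_g) b (- vec_e) c (- vec_g) = region NE"
    unfolding v2 maximal_staircase_def staircase_cell_NE NE_def region_Union
    by (rule arg_cong[of _ _ Union]) blast
  have min: "min a b = a" "min b c = c" using assms by auto
  have nw: "U m n \<in> NW \<longleftrightarrow> - int c \<le> m \<and> n < int (a + c) \<and> m + 2 * int c < n"
    "W m n \<in> NW \<longleftrightarrow> - int c \<le> m \<and> n < int (a + c) \<and> m + 2 * int c < n" for m n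
  proof -
    have "(\<exists>i j. m = - int c + int j - 1 \<and> n = int (a + c) - int i \<and> 1 \<le> i \<and> 1 \<le> j \<and> i + j \<le> a)
       \<longleftrightarrow> - int c \<le> m \<and> n < int (a + c) \<and> m + 2 * int c < n"
    proof (intro iffI)
      assume "- int c \<le> m \<and> n < int (a + c) \<and> m + 2 * int c < n"
      then show "\<exists>i j. m = - int c + int j - 1 \<and> n = int (a + c) - int i \<and> 1 \<le> i \<and> 1 \<le> j \<and> i + j \<le> a"
        by (intro exI[of _ "nat (int (a + c) - n)"] exI[of _ "nat (m + int c + 1)"]) auto
    qed auto
    moreover have "U m n \<in> NW \<longleftrightarrow> (\<exists>i j. m = - int c + int j - 1 \<and> n = int (a + c) - int i \<and> 1 \<le> i \<and> 1 \<le> j \<and> i + j \<le> a)"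
      "W m n \<in> NW \<longleftrightarrow> (\<exists>i j. m = - int c + int j - 1 \<and> n = int (a + c) - int i \<and> 1 \<le> i \<and> 1 \<le> j \<and> i + j \<le> a)"
      unfolding NW_def min by blast+
    ultimately show "U m n \<in> NW \<longleftrightarrow> - int c \<le> m \<and> n < int (a + c) \<and> m + 2 * int c < n"
    "W m n \<in> NW \<longleftrightarrow> - int c \<le> m \<and> n < int (a + c) \<and> m + 2 * int c < n" by simp_all
  qed
  have ne_aux: "(\<exists>i j. m = int b - int c + int j - int i \<and> n = int (a + c) - int j \<and> 1 \<le> i \<and> 1 \<le> j \<and> i + j \<le> c)
       \<longleftrightarrow> m + n < int (a + b) \<and> n < int (a + c) \<and> 2 * int a + int b \<le> 2 * n + m" for m n
  proof (intro iffI)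
    assume "m + n < int (a + b) \<and> n < int (a + c) \<and> 2 * int a + int b \<le> 2 * n + m"
    then show "\<exists>i j. m = int b - int c + int j - int i \<and> n = int (a + c) - int j \<and> 1 \<le> i \<and> 1 \<le> j \<and> i + j \<le> c"
      by (intro exI[of _ "nat (int (a + b) - n - m)"] exI[of _ "nat (int (a + c) - n)"]) auto
  qed auto
  have ne: "U m n \<in> NE \<longleftrightarrow> m + n < int (a + b) \<and> n < int (a + c) \<and> 2 * int a + int b \<le> 2 * n + m"
    "W m n \<in> NE \<longleftrightarrow> m + 1 + n < int (a + b) \<and> n < int (a + c) \<and> 2 * int a + int b \<le> 2 * n + (m + 1)" for m n
  proof -
    have "U m n \<in> NE \<longleftrightarrow> (\<exists>i j. m = int b - int c + int j - int i \<and> n = int (a + c) - int j \<and> 1 \<le> i \<and> 1 \<le> j \<and> i + j \<le> c)"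
      unfolding NE_def min by blast
    then show "U m n \<in> NE \<longleftrightarrow> m + n < int (a + b) \<and> n < int (a + c) \<and> 2 * int a + int b \<le> 2 * n + m"
      unfolding ne_aux .
    have "W m n \<in> NE \<longleftrightarrow> (\<exists>i j. m = int b - int c + int j - int i - 1 \<and> n = int (a + c) - int j \<and> 1 \<le> i \<and> 1 \<le> j \<and> i + j \<le> c)"
      unfolding NE_def min by blast
    also have "\<dots> \<longleftrightarrow> (\<exists>i j. m + 1 = int b - int c + int j - int i \<and> n = int (a + c) - int j \<and> 1 \<le> i \<and> 1 \<le> j \<and> i + j \<le> c)"
      by (simp add: eq_diff_eq)
    finally show "W m n \<in> NE \<longleftrightarrow> m + 1 + n < int (a + b) \<and> n < int (a + c) \<and> 2 * int a + int b \<le> 2 * n + (m + 1)"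
      unfolding ne_aux .
  qed
  have "t \<in> {t. in_hexagon a b c t} - (NW \<union> NE) \<longleftrightarrow> in_Ha a b c t" for t
    by (cases t) (auto simp: nw ne)
  then have X: "{t. in_hexagon a b c t} - (NW \<union> NE) = {t. in_Ha a b c t}" by blast
  have "hexagon_a a b c = closure (region {t. in_hexagon a b c t} - region (NW \<union> NE))"
    unfolding hexagon_a_def Let_def s1 s2 hexagon_region[OF assms(2,1)]
    by (rule arg_cong[of _ _ closure]) (auto simp: region_def)
  also have "\<dots> = region ({t. in_hexagon a b c t} - (NW \<union> NE))"
    by (rule closure_region_diff[OF finite_in_hexagon])
  finally show ?thesis unfolding X .
qed

section \<open>Counting covers along vertical strips\<close>

lemma dimers_nonempty: "l \<in> dimers \<Longrightarrow> l \<noteq> {}"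
  by (auto simp: dimers_def)

lemma dimersI: "{U m n, W m n} \<in> dimers" "{U m n, W m (n - 1)} \<in> dimers" "{U m n, W (m - 1) n} \<in> dimers"
  unfolding dimers_def by blast+

lemma finite_dimer_covers: "finite X \<Longrightarrow> finite (dimer_covers X)"
  by (rule finite_subset[of _ "Pow (Pow X)"]) (auto simp: dimer_covers_def)

lemma dimer_covers_empty: "dimer_covers {} = {{}}"
  using dimers_nonempty by (auto simp: dimer_covers_def)

lemma dimer_covers_split:
  assumes "t \<in> X"
  shows "dimer_covers X = (\<Union>l\<in>{l \<in> dimers. t \<in> l \<and> l \<subseteq> X}. insert l ` dimer_covers (X - l))"
proof (intro equalityI subsetI)
  fix M assume M: "M \<in> dimer_covers X"
  then obtain l where l: "l \<in> M" "t \<in> l" using assms by (auto simp: dimer_covers_def)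
  have sub: "l \<in> dimers" "l \<subseteq> X" using M l by (auto simp: dimer_covers_def)
  have "A \<inter> l = {}" if "A \<in> M - {l}" for A
    using M l that by (auto simp: dimer_covers_def pairwise_def disjnt_def)
  then have "\<Union> (M - {l}) = X - l" using M l by (auto simp: dimer_covers_def)
  then have "M - {l} \<in> dimer_covers (X - l)"
    using M by (auto simp: dimer_covers_def intro: pairwise_subset)
  moreover have "M = insert l (M - {l})" using l by blast
  ultimately show "M \<in> (\<Union>l\<in>{l \<in> dimers. t \<in> l \<and> l \<subseteq> X}. insert l ` dimer_covers (X - l))"
    using sub l(2) by blast
next
  fix M assume "M \<in> (\<Union>l\<in>{l \<in> dimers. t \<in> l \<and> l \<subseteq> X}. insert l ` dimer_covers (X - l))"
  then obtain l M' where l: "l \<in> dimers" "t \<in> l" "l \<subseteq> X" "M' \<in> dimer_covers (X - l)" "M = insert l M'" by blast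
  have "disjnt l A" if "A \<in> M'" for A using l(4) that by (auto simp: dimer_covers_def disjnt_def)
  then show "M \<in> dimer_covers X"
    using l by (auto simp: dimer_covers_def pairwise_insert disjnt_sym)
qed

text \<open>Every cover contains exactly one dimer at a given triangle.\<close>
lemma card_dimer_covers_split:
  assumes "finite X" "t \<in> X"
  shows "card (dimer_covers X) = (\<Sum>l\<in>{l \<in> dimers. t \<in> l \<and> l \<subseteq> X}. card (dimer_covers (X - l)))"
proof -
  let ?L = "{l \<in> dimers. t \<in> l \<and> l \<subseteq> X}"
  have notin: "l \<notin> M" if "l \<in> ?L" "M \<in> dimer_covers (X - l)" for l M
    using that by (auto simp: dimer_covers_def)
  have "finite ?L" using assms(1) by (auto intro: finite_subset[of _ "Pow X"])
  moreover have "\<forall>l\<in>?L. finite (insert l ` dimer_covers (X - l))"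
    using assms(1) by (simp add: finite_dimer_covers)
  moreover have "insert l ` dimer_covers (X - l) \<inter> insert l' ` dimer_covers (X - l') = {}"
    if "l \<in> ?L" "l' \<in> ?L" "l \<noteq> l'" for l l'
  proof (rule ccontr)
    assume "\<not> ?thesis"
    then obtain M where M: "M \<in> insert l ` dimer_covers (X - l)" "M \<in> insert l' ` dimer_covers (X - l')" by blast
    then have "M \<in> dimer_covers X" using that dimer_covers_split[OF assms(2)] by blast
    moreover have "l \<in> M" "l' \<in> M" using M by auto
    ultimately have "l \<inter> l' = {}" using that(3) by (auto simp: dimer_covers_def pairwise_def disjnt_def)
    then show False using that by auto
  qed
  ultimately have "card (dimer_covers X) = (\<Sum>l\<in>?L. card (insert l ` dimer_covers (X - l)))"
    unfolding dimer_covers_split[OF assms(2)] by (intro card_UN_disjoint) auto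
  also have "\<dots> = (\<Sum>l\<in>?L. card (dimer_covers (X - l)))"
  proof (intro sum.cong refl card_image inj_onI)
    fix l M M' assume "l \<in> ?L" "M \<in> dimer_covers (X - l)" "M' \<in> dimer_covers (X - l)" "insert l M = insert l M'"
    then show "M = M'" using notin insert_ident by metis
  qed
  finally show ?thesis .
qed

lemma card_dimer_covers_W:
  assumes "finite X" "W m n \<in> X" "U (m + 1) n \<notin> X"
  shows "card (dimer_covers X) = (if U m n \<in> X then card (dimer_covers (X - {U m n, W m n})) else 0)
     + (if U m (n + 1) \<in> X then card (dimer_covers (X - {U m (n + 1), W m n})) else 0)"
proof -
  have e: "{l \<in> dimers. W m n \<in> l \<and> l \<subseteq> X} = (if U m n \<in> X then {{U m n, W m n}} else {})
     \<union> (if U m (n + 1) \<in> X then {{U m (n + 1), W m n}} else {})" (is "?L = ?R")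
  proof (intro equalityI subsetI)
    fix l assume "l \<in> ?L"
    then have l: "l \<in> dimers" "W m n \<in> l" "l \<subseteq> X" by auto
    then have "l = {U m n, W m n} \<or> l = {U m (n + 1), W m n} \<or> l = {U (m + 1) n, W m n}"
      by (auto simp: dimers_def)
    then show "l \<in> ?R" using l assms(3) by auto
  next
    fix l assume "l \<in> ?R"
    then have "l = {U m n, W m n} \<and> U m n \<in> X \<or> l = {U m (n + 1), W m n} \<and> U m (n + 1) \<in> X"
      by (auto split: if_splits)
    moreover have "{U m n, W m n} \<in> dimers" "{U m (n + 1), W m n} \<in> dimers"
      using dimersI(1)[of m n] dimersI(2)[of m "n + 1"] by simp_all
    ultimately show "l \<in> ?L" using assms(2) by auto
  qed
  show ?thesis unfolding card_dimer_covers_split[OF assms(1,2)] e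
    by (auto simp: doubleton_eq_iff)
qed

lemma card_dimer_covers_U:
  assumes "finite X" "U m n \<in> X" "W m n \<notin> X" "W m (n - 1) \<notin> X"
  shows "card (dimer_covers X) = (if W (m - 1) n \<in> X then card (dimer_covers (X - {U m n, W (m - 1) n})) else 0)"
proof -
  have e: "{l \<in> dimers. U m n \<in> l \<and> l \<subseteq> X} = (if W (m - 1) n \<in> X then {{U m n, W (m - 1) n}} else {})" (is "?L = ?R")
  proof (intro equalityI subsetI)
    fix l assume "l \<in> ?L"
    then have l: "l \<in> dimers" "U m n \<in> l" "l \<subseteq> X" by auto
    then have "l = {U m n, W m n} \<or> l = {U m n, W m (n - 1)} \<or> l = {U m n, W (m - 1) n}"
      by (auto simp: dimers_def)
    then show "l \<in> ?R" using l assms(3,4) by auto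
  next
    fix l assume "l \<in> ?R"
    then have "l = {U m n, W (m - 1) n} \<and> W (m - 1) n \<in> X"
      by (auto split: if_splits)
    moreover have "{U m n, W (m - 1) n} \<in> dimers" by (rule dimersI)
    ultimately show "l \<in> ?L" using assms(2) by auto
  qed
  show ?thesis unfolding card_dimer_covers_split[OF assms(1,2)] e by auto
qed

text \<open>If all triangles \<open>U m n\<close> of strip \<open>m\<close> have lost their neighbours in that strip, they are
  matched across the line to their left.\<close>
lemma card_dimer_covers_forced:
  assumes "finite N" "finite X" "\<And>n. U m n \<in> X \<longleftrightarrow> n \<in> N" "\<And>n. W m n \<notin> X"
  shows "card (dimer_covers X) = (if \<forall>n\<in>N. W (m - 1) n \<in> X
     then card (dimer_covers (X - (\<Union>n\<in>N. {U m n, W (m - 1) n}))) else 0)"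
  using assms
proof (induction N arbitrary: X rule: finite_induct)
  case (insert n N)
  have 1: "card (dimer_covers X) = (if W (m - 1) n \<in> X then card (dimer_covers (X - {U m n, W (m - 1) n})) else 0)"
    by (rule card_dimer_covers_U) (use insert.prems in auto)
  have 2: "card (dimer_covers (X - {U m n, W (m - 1) n})) = (if \<forall>n'\<in>N. W (m - 1) n' \<in> X - {U m n, W (m - 1) n}
     then card (dimer_covers (X - {U m n, W (m - 1) n} - (\<Union>n\<in>N. {U m n, W (m - 1) n}))) else 0)"
    by (rule insert.IH) (use insert.prems insert.hyps in auto)
  have 3: "X - {U m n, W (m - 1) n} - (\<Union>n\<in>N. {U m n, W (m - 1) n}) = X - (\<Union>n\<in>insert n N. {U m n, W (m - 1) n})"
    by auto
  have 4: "(\<forall>n'\<in>N. W (m - 1) n' \<in> X - {U m n, W (m - 1) n}) \<longleftrightarrow> (\<forall>n'\<in>N. W (m - 1) n' \<in> X)"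
    using insert.hyps by auto
  show ?case unfolding 1 2 3 4 by auto
qed simp

text \<open>The number of paths with \<open>k - i\<close> steps that start on line \<open>i\<close> at height \<open>c + i\<close>, go down by one in
  some of the steps, arrive at height \<open>v\<close> on line \<open>k\<close>, and do not touch the wall
  \<open>2 v + k = 2 a + b + c\<close>, by the reflection principle: the second term counts the paths to the mirror
  image of the end point.\<close>
definition path_count :: "nat \<Rightarrow> nat \<Rightarrow> nat \<Rightarrow> nat \<Rightarrow> int \<Rightarrow> nat \<Rightarrow> real" where
  "path_count a b c k v i = int_choose (k - i) (int c + int i - v) - int_choose (k - i) (int i + int k + v - 2 * int a - int b)"

lemma path_count_Suc:
  assumes "i \<le> k"
  shows "path_count a b c (Suc k) v i = path_count a b c k v i + path_count a b c k (v + 1) i"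
  using assms by (simp add: path_count_def Suc_diff_le int_choose_Suc algebra_simps)

text \<open>The part of the region to the left of a frontier that is being moved across the strip \<open>k\<close>, where
  \<open>m = k - c\<close>. The paths cross the frontier at the heights \<open>R\<close> on the right line of the
  strip and, where the frontier has already moved back, at the heights \<open>S\<close> on its left line. The
  triangles \<open>U\<close> of the strip at the heights in \<open>S\<close> are covered by lozenges beyond the frontier.\<close>
fun in_part :: "nat \<Rightarrow> nat \<Rightarrow> nat \<Rightarrow> nat \<Rightarrow> int list \<Rightarrow> int list \<Rightarrow> tri \<Rightarrow> bool" where
  "in_part a b c k R S (U m n) \<longleftrightarrow> in_Ha a b c (U m n) \<and> (m < int k - int c \<or> m = int k - int c \<and> n \<notin> set S)"
| "in_part a b c k R S (W m n) \<longleftrightarrow> in_Ha a b c (W m n) \<and> m < int k - int c \<or> m = int k - int c \<and> n \<in> set R"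

lemma finite_in_Ha: "finite {t. in_Ha a b c t}"
proof (rule finite_subset[OF _ finite_in_hexagon])
  have "in_hexagon a b c t" if "in_Ha a b c t" for t
    using that by (cases t) auto
  then show "{t. in_Ha a b c t} \<subseteq> {t. in_hexagon a b c t}" by blast
qed

lemma finite_in_part: "finite {t. in_part a b c k R S t}"
proof (rule finite_subset)
  show "{t. in_part a b c k R S t} \<subseteq> {t. in_Ha a b c t} \<union> W (int k - int c) ` set R"
  proof
    fix t assume "t \<in> {t. in_part a b c k R S t}"
    then show "t \<in> {t. in_Ha a b c t} \<union> W (int k - int c) ` set R"
      by (cases t) auto
  qed
qed (simp add: finite_in_Ha)

abbreviation "covers_count a b c k R S \<equiv> card (dimer_covers {t. in_part a b c k R S t})"

text \<open>The uppermost crossing on the right line comes from the same height or from one higher on the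
  left line.\<close>
lemma covers_count_step:
  assumes "r \<notin> set R" "r \<notin> set S"
  shows "covers_count a b c k (R @ [r]) S =
    (if in_Ha a b c (U (int k - int c) r) then covers_count a b c k R (r # S) else 0)
    + (if in_Ha a b c (U (int k - int c) (r + 1)) \<and> r + 1 \<notin> set S then covers_count a b c k R ((r + 1) # S) else 0)"
proof -
  let ?X = "{t. in_part a b c k (R @ [r]) S t}" and ?m = "int k - int c"
  have "?X - {U ?m r, W ?m r} = {t. in_part a b c k R (r # S) t}"
    "?X - {U ?m (r + 1), W ?m r} = {t. in_part a b c k R ((r + 1) # S) t}"
  proof -
    have "t \<in> ?X - {U ?m r, W ?m r} \<longleftrightarrow> in_part a b c k R (r # S) t"
      "t \<in> ?X - {U ?m (r + 1), W ?m r} \<longleftrightarrow> in_part a b c k R ((r + 1) # S) t" for t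
      using assms(1) by (cases t; auto)+
    then show "?X - {U ?m r, W ?m r} = {t. in_part a b c k R (r # S) t}"
      "?X - {U ?m (r + 1), W ?m r} = {t. in_part a b c k R ((r + 1) # S) t}" by blast+
  qed
  moreover have "card (dimer_covers ?X) = (if U ?m r \<in> ?X then card (dimer_covers (?X - {U ?m r, W ?m r})) else 0)
     + (if U ?m (r + 1) \<in> ?X then card (dimer_covers (?X - {U ?m (r + 1), W ?m r})) else 0)"
    by (rule card_dimer_covers_W) (simp_all add: finite_in_part del: in_Ha.simps)
  ultimately show ?thesis using assms(2) by (simp del: in_Ha.simps)
qed

text \<open>Below the region: no path can have come down so far.\<close>
lemma path_count_vanish_below:
  assumes "in_Ha a b c (W (int k - int c) r)" "\<not> in_Ha a b c (U (int k - int c) r)" "i \<le> k" "i < a" "a + c \<le> b + 1"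
  shows "path_count a b c k r i = 0"
proof -
  have "r = int c - int k - 1" using assms by auto
  then have "int (k - i) < int c + int i - r" "int i + int k + r - 2 * int a - int b < 0"
    using assms(3-5) by auto
  then show ?thesis by (simp add: path_count_def int_choose_neg int_choose_big)
qed

text \<open>Above the region there are three cases: the height exceeds all starts up to line \<open>k\<close>, because of the left
  staircase or of the upper side, or it lies on the wall, where the two binomial coefficients are equal.\<close>
lemma path_count_vanish_above:
  assumes "in_Ha a b c (W (int k - int c) r)" "\<not> in_Ha a b c (U (int k - int c) (r + 1))" "i \<le> k" "i < a" "a + c \<le> b + 1"
  shows "path_count a b c k (r + 1) i = 0"
proof -
  consider "r = int k + int c" "k < a" | "r + 1 = int a + int c" "int k + int c \<le> int b"
    | "2 * (r + 1) + int k = 2 * int a + int b + int c"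
    using assms(1,2) by auto
  then show ?thesis
  proof cases
    case 3
    then have "int c + int i - (r + 1) = int i + int k + (r + 1) - 2 * int a - int b" by simp
    then show ?thesis by (simp only: path_count_def diff_self)
  qed (use assms(3-5) in \<open>auto simp: path_count_def int_choose_neg\<close>)
qed

text \<open>When all crossings have been moved to the left line of the strip, the remaining triangles \<open>U\<close> of the strip are
  covered together with the triangles \<open>W\<close> on the other side of this line. The only triangle \<open>U\<close> without such
  a neighbour is the one at the start of the \<open>k\<close>-th path, so a path must be there.\<close>
lemma forced_holes:
  assumes "k < b + c" "1 \<le> k" "a + c \<le> b + 1"
    and "\<And>s. s \<in> set S \<Longrightarrow> in_Ha a b c (U (int k - int c) s)"
    and "k < a \<Longrightarrow> int c + int k \<in> set S"
    and "set R = (if k < a then set S - {int c + int k} else set S)"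
  shows "covers_count a b c k [] S = covers_count a b c (k - 1) R []"
proof -
  let ?X = "{t. in_part a b c k [] S t}" and ?m = "int k - int c"
  define N where "N = {n. in_Ha a b c (U ?m n) \<and> n \<notin> set S}"
  have UW: "in_Ha a b c (U ?m n) \<longleftrightarrow> in_Ha a b c (W (?m - 1) n) \<or> (k < a \<and> n = int c + int k)" for n
    using assms(1-3) by auto
  have notW: "\<not> in_Ha a b c (W (?m - 1) (int c + int k))" by auto
  have "finite N" unfolding N_def
    by (rule finite_subset[of _ "{0..int (a + c)}"]) auto
  moreover have "W (?m - 1) n \<in> ?X" if "n \<in> N" for n
    using that assms(5) by (auto simp: N_def UW simp del: in_Ha.simps)
  ultimately have "card (dimer_covers ?X) = card (dimer_covers (?X - (\<Union>n\<in>N. {U ?m n, W (?m - 1) n})))"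
    using card_dimer_covers_forced[of N ?X ?m] by (simp add: finite_in_part N_def del: in_Ha.simps)
  also have "?X - (\<Union>n\<in>N. {U ?m n, W (?m - 1) n}) = {t. in_part a b c (k - 1) R [] t}"
  proof -
    have mem: "n \<in> set R \<longleftrightarrow> in_Ha a b c (W (?m - 1) n) \<and> n \<in> set S" for n
      using assms(4)[of n] notW by (auto simp: assms(6) UW simp del: in_Ha.simps)
    have "t \<in> ?X - (\<Union>n\<in>N. {U ?m n, W (?m - 1) n}) \<longleftrightarrow> in_part a b c (k - 1) R [] t" for t
    proof (cases t)
      case (U m n)
      then show ?thesis using assms(2) by (auto simp: N_def simp del: in_Ha.simps)
    next
      case (W m n)
      have "int (k - 1) - int c = ?m - 1" using assms(2) by simp
      then show ?thesis unfolding W using UW[of n]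
        by (cases "m = ?m - 1") (auto simp: N_def mem simp del: in_Ha.simps)
    qed
    then show ?thesis by blast
  qed
  finally show ?thesis .
qed

lemma no_cover_without_start:
  assumes "k < b + c" "k < a" "1 \<le> k" "a + c \<le> b + 1" "int c + int k \<notin> set S"
  shows "covers_count a b c k [] S = 0"
proof -
  let ?X = "{t. in_part a b c k [] S t}" and ?m = "int k - int c"
  have "card (dimer_covers ?X) = (if W (?m - 1) (int c + int k) \<in> ?X
     then card (dimer_covers (?X - {U ?m (int c + int k), W (?m - 1) (int c + int k)})) else 0)"
    by (rule card_dimer_covers_U) (use assms finite_in_part in auto)
  then show ?thesis by auto
qed

lemma path_count_start_row:
  assumes "k < a" "a + c \<le> b + 1" "v \<le> int c + int k"
  shows "path_count a b c k v k = (if v = int c + int k then 1 else 0)"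
proof -
  have "int k + int k + v - 2 * int a - int b < 0" using assms by linarith
  then show ?thesis using assms(3) by (auto simp: path_count_def int_choose_neg int_choose_big) (simp add: int_choose_def)
qed

declare in_Ha.simps [simp del]

text \<open>The columns of the determinant are the crossings in increasing order. The column of the uppermost
  crossing on the right line is split by Pascal's recurrence into the columns of its two possible
  predecessors. If a predecessor is outside the region, its column is zero; if it is already
  occupied, two columns agree; otherwise the induction hypothesis applies. The hypothesis \<open>base\<close> is the
  situation in which no crossing is left on the right line.\<close>
lemma covers_count_det_strip:
  assumes "a + c \<le> b + 1"
    and base: "\<And>S. sorted_wrt (<) S \<Longrightarrow> length S = min (k + 1) a \<Longrightarrow>
      (\<And>s. s \<in> set S \<Longrightarrow> in_Ha a b c (U (int k - int c) s)) \<Longrightarrow>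
      real (covers_count a b c k [] S) = det_fn (min (k + 1) a) (\<lambda>i j. (map (path_count a b c k) S ! j) i)"
    and "sorted_wrt (<) (R @ S)" "length (R @ S) = min (k + 1) a"
    and "\<And>r. r \<in> set R \<Longrightarrow> in_Ha a b c (W (int k - int c) r)"
    and "\<And>s. s \<in> set S \<Longrightarrow> in_Ha a b c (U (int k - int c) s)"
  shows "real (covers_count a b c k R S) =
    det_fn (min (k + 1) a) (\<lambda>i j. ((map (path_count a b c (Suc k)) R @ map (path_count a b c k) S) ! j) i)"
  using assms(3-)
proof (induction R arbitrary: S rule: rev_induct)
  case Nil
  then show ?case using base[of S] by simp
next
  case (snoc r R)
  define n where "n = min (k + 1) a"
  define s where "s = length R"
  let ?P = "path_count a b c k" and ?P' = "path_count a b c (Suc k)"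
  let ?UD = "\<lambda>v. in_Ha a b c (U (int k - int c) v)"
  define F where "F i j = ((map ?P' R @ map ?P (r # S)) ! j) i" for i j
  have ik: "i \<le> k" "i < a" if "i < n" for i using that by (auto simp: n_def)
  have len: "s + Suc (length S) = n" using snoc.prems(2) by (simp add: n_def s_def)
  then have sn: "s < n" by simp
  have col: "((map ?P' R @ g # map ?P S) ! j) i = (if j = s then g i else F i j)" for g i j
  proof (cases "s < j")
    case True
    then obtain d where "j = Suc (s + d)" using less_imp_Suc_add by blast
    then show ?thesis by (simp add: F_def s_def nth_append)
  qed (auto simp: F_def s_def nth_append)
  have sorted: "sorted_wrt (<) R" "sorted_wrt (<) S" "\<And>x y. x \<in> set R \<Longrightarrow> y \<in> set S \<Longrightarrow> x < y"
    "\<And>x. x \<in> set R \<Longrightarrow> x < r" "\<And>y. y \<in> set S \<Longrightarrow> r < y"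
    using snoc.prems(1) by (auto simp: sorted_wrt_append)
  have WD: "in_Ha a b c (W (int k - int c) r)" by (rule snoc.prems(3)) simp
  have "det_fn n (\<lambda>i j. ((map ?P' (R @ [r]) @ map ?P S) ! j) i) = det_fn n (\<lambda>i j. if j = s then ?P r i + ?P (r + 1) i else F i j)"
  proof (rule det_fn_cong)
    fix i j assume "i < n" "j < n"
    have "((map ?P' (R @ [r]) @ map ?P S) ! j) i = ((map ?P' R @ ?P' r # map ?P S) ! j) i"
      by (simp only: map_append list.map append_assoc append_Cons append_Nil)
    also have "\<dots> = (if j = s then ?P r i + ?P (r + 1) i else F i j)"
      unfolding col using path_count_Suc[OF ik(1)[OF \<open>i < n\<close>]] by simp
    finally show "((map ?P' (R @ [r]) @ map ?P S) ! j) i = \<dots>" .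
  qed
  also have "\<dots> = det_fn n (\<lambda>i j. if j = s then ?P r i else F i j) + det_fn n (\<lambda>i j. if j = s then ?P (r + 1) i else F i j)"
    by (rule det_fn_column_add[OF sn])
  also have "det_fn n (\<lambda>i j. if j = s then ?P r i else F i j) = (if ?UD r then real (covers_count a b c k R (r # S)) else 0)"
  proof (cases "?UD r")
    case True
    have "real (covers_count a b c k R (r # S)) = det_fn n (\<lambda>i j. ((map ?P' R @ map ?P (r # S)) ! j) i)"
      unfolding n_def
      by (rule snoc.IH) (use snoc.prems True in \<open>auto simp: sorted_wrt_append\<close>)
    then show ?thesis using True by (simp only: list.map col if_True)
  next
    case False
    have "det_fn n (\<lambda>i j. if j = s then ?P r i else F i j) = 0"
      by (rule det_fn_zero_column[OF sn]) (use path_count_vanish_below[OF WD False _ _ assms(1)] ik in auto)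
    then show ?thesis using False by simp
  qed
  also have "det_fn n (\<lambda>i j. if j = s then ?P (r + 1) i else F i j)
    = (if ?UD (r + 1) \<and> r + 1 \<notin> set S then real (covers_count a b c k R ((r + 1) # S)) else 0)"
  proof -
    consider "\<not> ?UD (r + 1)" | "r + 1 \<in> set S" | "?UD (r + 1)" "r + 1 \<notin> set S" by blast
    then show ?thesis
    proof cases
      case 1
      have "det_fn n (\<lambda>i j. if j = s then ?P (r + 1) i else F i j) = 0"
        by (rule det_fn_zero_column[OF sn]) (use path_count_vanish_above[OF WD 1 _ _ assms(1)] ik in auto)
      then show ?thesis using 1 by simp
    next
      case 2
      then obtain q where q: "q < length S" "S ! q = r + 1" by (auto simp: in_set_conv_nth)
      have "det_fn n (\<lambda>i j. if j = s then ?P (r + 1) i else F i j) = 0"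
      proof (rule det_fn_identical_columns[OF sn])
        show "s + 1 + q < n" using q len by simp
        show "(if s = s then ?P (r + 1) i else F i s) = (if s + 1 + q = s then ?P (r + 1) i else F i (s + 1 + q))" for i
          using q by (simp add: F_def s_def nth_append)
      qed simp
      then show ?thesis using 2 by simp
    next
      case 3
      have "r + 1 < y" if "y \<in> set S" for y using sorted(5)[OF that] 3(2) that by (cases "y = r + 1") auto
      then have "real (covers_count a b c k R ((r + 1) # S)) = det_fn n (\<lambda>i j. ((map ?P' R @ map ?P ((r + 1) # S)) ! j) i)"
        unfolding n_def
        by (intro snoc.IH) (use snoc.prems 3 sorted in \<open>force simp: sorted_wrt_append\<close>)+
      then show ?thesis using 3 by (simp only: list.map col if_True simp_thms)
    qed
  qed
  also have "(if ?UD r then real (covers_count a b c k R (r # S)) else 0)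
     + (if ?UD (r + 1) \<and> r + 1 \<notin> set S then real (covers_count a b c k R ((r + 1) # S)) else 0)
    = real (covers_count a b c k (R @ [r]) S)"
  proof -
    have "r \<notin> set R" "r \<notin> set S" using sorted(4)[of r] sorted(5)[of r] by auto
    then show ?thesis by (simp add: covers_count_step)
  qed
  finally show ?case unfolding n_def by simp
qed

text \<open>On line \<open>k < a\<close> a new path starts at the height \<open>c + k\<close>, which is the largest one that occurs,
  and its row is \<open>(0, ..., 0, 1)\<close>; expansion along this row removes the path. If the path is missing, the row is zero
  and there is no cover.\<close>
lemma covers_count_det_line:
  assumes "1 \<le> a" "a + c \<le> b + 1" "k < b + c"
    and "sorted_wrt (<) S" "length S = min (k + 1) a"
    and "\<And>s. s \<in> set S \<Longrightarrow> in_Ha a b c (U (int k - int c) s)"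
  shows "real (covers_count a b c k [] S) = det_fn (min (k + 1) a) (\<lambda>i j. (map (path_count a b c k) S ! j) i)"
  using assms(3-)
proof (induction k arbitrary: S)
  case 0
  then obtain s where S: "S = [s]" using assms(1) by (auto simp: length_Suc_conv)
  have s: "s = int c" using "0.prems"(4)[of s] by (simp add: S in_Ha.simps)
  have "in_part a b c 0 [] S t = False" for t by (cases t) (auto simp: S s in_Ha.simps)
  then have "covers_count a b c 0 [] S = 1" by (simp add: dimer_covers_empty)
  moreover have "det_fn (Suc 0) (\<lambda>i j. (map (path_count a b c 0) S ! j) i) = path_count a b c 0 s 0"
    by (subst det_fn_expand_column[of 0]) (simp_all add: S)
  moreover have "path_count a b c 0 s 0 = 1" using path_count_start_row[of 0 a c b s] assms s by simp
  moreover have "min (0 + 1) a = Suc 0" using assms(1) by simp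
  ultimately show ?case by simp
next
  case (Suc k)
  let ?P = "path_count a b c (Suc k)"
  have strip: "real (covers_count a b c k R []) = det_fn (min (k + 1) a) (\<lambda>i j. (map ?P R ! j) i)"
    if "sorted_wrt (<) R" "length R = min (k + 1) a" "\<And>r. r \<in> set R \<Longrightarrow> in_Ha a b c (W (int k - int c) r)" for R
  proof -
    have k: "k < b + c" using Suc.prems(1) by simp
    have "real (covers_count a b c k R []) =
      det_fn (min (k + 1) a) (\<lambda>i j. ((map ?P R @ map (path_count a b c k) []) ! j) i)"
      by (rule covers_count_det_strip[OF assms(2)], rule Suc.IH[OF k], assumption, assumption, assumption)
        (simp_all add: that)
    then show ?thesis by simp
  qed
  have UD: "in_Ha a b c (U (int (Suc k) - int c) s) \<Longrightarrow> s \<noteq> int c + int (Suc k) \<or> a \<le> Suc k \<Longrightarrow> in_Ha a b c (W (int k - int c) s)" for s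
    by (auto simp: in_Ha.simps)
  show ?case
  proof (cases "Suc k < a")
    case False
    have "covers_count a b c (Suc k) [] S = covers_count a b c k S []"
      using forced_holes[OF Suc.prems(1) _ assms(2) Suc.prems(4), where R=S] False by simp
    moreover have "min (Suc k + 1) a = a" "min (k + 1) a = a" using False by auto
    ultimately show ?thesis
      using strip[OF Suc.prems(2)] UD[OF Suc.prems(4)] Suc.prems(3) False by simp
  next
    case True
    let ?v = "int c + int (Suc k)"
    have m: "min (Suc k + 1) a = Suc (Suc k)" "min (k + 1) a = Suc k" using True by auto
    have le: "s \<le> ?v" if "s \<in> set S" for s using Suc.prems(4)[OF that] by (auto simp: in_Ha.simps)
    have row: "(map ?P S ! j) (Suc k) = (if S ! j = ?v then 1 else 0)" if "j < Suc (Suc k)" for j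
      using that path_count_start_row[OF True assms(2), of "S ! j"] le[of "S ! j"] Suc.prems(3) m by simp
    show ?thesis
    proof (cases "?v \<in> set S")
      case False
      have "det_fn (Suc (Suc k)) (\<lambda>i j. (map ?P S ! j) i) = det_fn (Suc (Suc k)) (\<lambda>j i. (map ?P S ! j) i)"
        by (rule det_fn_transpose[symmetric])
      also have "\<dots> = 0"
      proof (rule det_fn_zero_column[of "Suc k"])
        fix j assume j: "j < Suc (Suc k)"
        then have "S ! j \<in> set S" using Suc.prems(3) m by simp
        then show "(map ?P S ! j) (Suc k) = 0" using row[OF j] False by auto
      qed simp
      finally show ?thesis
        using no_cover_without_start[OF Suc.prems(1) True _ assms(2) False] m by simp
    next
      case v: True
      then have "S \<noteq> []" by auto
      then obtain R x where S: "S = R @ [x]" by (metis rev_exhaust)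
      have "x = ?v"
        using v le[of x] Suc.prems(2) by (auto simp: S sorted_wrt_append)
      then have S: "S = R @ [?v]" using S by simp
      have R: "sorted_wrt (<) R" "length R = Suc k" "set R = set S - {?v}" "?v \<notin> set R"
        using Suc.prems(2,3) m by (auto simp: S sorted_wrt_append)
      have "det_fn (Suc (Suc k)) (\<lambda>i j. (map ?P S ! j) i) = (-1) ^ (Suc k + Suc k) * (map ?P S ! Suc k) (Suc k) *
         det_fn (Suc k) (\<lambda>i j. (map ?P S ! (insert_index (Suc k) j)) (insert_index (Suc k) i))"
      proof (rule det_fn_row_single)
        fix j assume "j < Suc (Suc k)" "j \<noteq> Suc k"
        then have "j < Suc k" by simp
        then have "S ! j \<in> set R" using R(2) by (simp add: S nth_append)
        then show "(map ?P S ! j) (Suc k) = 0" using row[of j] R(4) \<open>j < Suc k\<close> by auto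
      qed simp_all
      also have "(map ?P S ! Suc k) (Suc k) = 1"
        using row[of "Suc k"] R(2) by (simp add: S nth_append)
      also have "det_fn (Suc k) (\<lambda>i j. (map ?P S ! (insert_index (Suc k) j)) (insert_index (Suc k) i))
         = det_fn (Suc k) (\<lambda>i j. (map ?P R ! j) i)"
        by (rule det_fn_cong) (use R(2) in \<open>simp add: S nth_append\<close>)
      also have "\<dots> = real (covers_count a b c k R [])"
      proof (rule strip[symmetric, unfolded m, OF R(1,2)])
        fix r assume "r \<in> set R"
        then show "in_Ha a b c (W (int k - int c) r)" using R(3) UD[OF Suc.prems(4)[of r]] by auto
      qed
      also have "covers_count a b c k R [] = covers_count a b c (Suc k) [] S"
        using forced_holes[OF Suc.prems(1) _ assms(2) Suc.prems(4), where R=R] R(3) v True by simp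
      finally show ?thesis using m by (simp flip: power_add mult_2)
    qed
  qed
qed

text \<open>The last strip is bounded on the right by the south-eastern side of the hexagon, where the paths
  end at the heights \<open>0, ..., a - 1\<close>.\<close>
theorem card_dimer_covers_Ha:
  assumes "1 \<le> a" "1 \<le> c" "a + c \<le> b + 1"
  shows "real (card (dimer_covers {t. in_Ha a b c t})) =
    det_fn a (\<lambda>i l. int_choose (b + c - i) (int c + int i - int l) - int_choose (b + c - i) (int c + int i + int l - 2 * int a))"
proof -
  define k where "k = b + c - 1"
  define R where "R = map int [0..<a]"
  have k: "k < b + c" "min (k + 1) a = a" "int k - int c = int b - 1" "Suc k = b + c" using assms by (auto simp: k_def)
  have "in_Ha a b c t \<longleftrightarrow> in_part a b c k R [] t" for t
  proof (cases t)
    case (W m n)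
    have "n \<in> set R \<longleftrightarrow> 0 \<le> n \<and> n < int a"
      by (auto simp: R_def image_iff intro!: bexI[of _ "nat n"])
    then show ?thesis using assms unfolding W in_part.simps k(3) in_Ha.simps
      by (cases "m = int b - 1") auto
  qed (use k(3) in \<open>auto simp: in_Ha.simps\<close>)
  then have "real (card (dimer_covers {t. in_Ha a b c t})) = real (covers_count a b c k R [])" by simp
  also have "\<dots> = det_fn (min (k + 1) a) (\<lambda>i j. ((map (path_count a b c (Suc k)) R @ map (path_count a b c k) []) ! j) i)"
  proof (rule covers_count_det_strip[OF assms(3)])
    fix S assume "sorted_wrt (<) S" "length S = min (k + 1) a" "\<And>s. s \<in> set S \<Longrightarrow> in_Ha a b c (U (int k - int c) s)"
    then show "real (covers_count a b c k [] S) = det_fn (min (k + 1) a) (\<lambda>i j. (map (path_count a b c k) S ! j) i)"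
      by (rule covers_count_det_line[OF assms(1,3) k(1)])
  next
    show "sorted_wrt (<) (R @ [])" by (simp add: R_def sorted_wrt_map)
    show "length (R @ []) = min (k + 1) a" using k(2) by (simp add: R_def)
    fix r assume "r \<in> set R"
    then show "in_Ha a b c (W (int k - int c) r)"
      unfolding k(3) in_Ha.simps using assms by (auto simp: R_def)
  qed simp
  also have "\<dots> = det_fn a (\<lambda>i l. int_choose (b + c - i) (int c + int i - int l) - int_choose (b + c - i) (int c + int i + int l - 2 * int a))"
    unfolding k(2) by (rule det_fn_cong) (simp add: R_def path_count_def k(4) algebra_simps)
  finally show ?thesis .
qed

section \<open>The tiling formula\<close>

theorem theorem1p6:
  fixes a b c :: nat
  assumes "a \<ge> 1" and "b \<ge> 1" and "c \<ge> 1"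
    and "b \<ge> a + c - 1"
  shows "real (num_tilings (hexagon_a a b c)) = P_prod a (b - a) c"
proof -
  have le: "a + c \<le> b + 1" using assms(4) by simp
  have "real (num_tilings (hexagon_a a b c)) = real (card (dimer_covers {t. in_Ha a b c t}))"
    by (simp only: hexagon_a_region[OF assms] num_tilings_region)
  also have "\<dots> = det_fn a (\<lambda>i l. int_choose (b + c - i) (int c + int i - int l)
      - int_choose (b + c - i) (int c + int i + int l - 2 * int a))"
    by (rule card_dimer_covers_Ha[OF assms(1,3) le])
  also have "\<dots> = P_prod a (b - a) c"
    by (rule det_reflected_binomials[OF assms(1,3) le])
  finally show ?thesis .
qed

end
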